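(* Let $H,U$, $A,B,R,Q,Q_T,\overline Q,\overline Q_T,S,S_T$ and $T>0$ be as in the context, let $P\in C_s([0,T];\Sigma^+(H))$ be the unique mild solution of the backward Riccati equation $$P'(t)+P(t)A+A^*P(t)-P(t)BR^{-1}B^*P(t)+Q+\overline Q=0,\qquad P(T)=Q_T+\overline Q_T,$$ and let $A_n=n^2R(n,A)-nI$ be the Yosida approximations of $A$. If $-\overline QS\in\Sigma^+(H)$ and $-\overline Q_TS_T\in\Sigma^+(H)$, then: (H1) for every $n$ the Riccati equation $$\eta_n'(t)=(P(t)BR^{-1}B^*-A_n^* )\eta_n(t)-\eta_n(t)(A_n-BR^{-1}B^*P(t))+\overline QS+\eta_n(t)BR^{-1}B^*\eta_n(t),\qquad \eta_n(T)=-\overline Q_TS_T,$$ admits a strict solution $\eta_n\in C^1_s([0,T];\Sigma(H))$; (H2) these solutions satisfy $\displaystyle\sup_{t\in[0,T],\,n}\|\eta_n(t)\|_{\mathcal L(H)}<\infty$.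
   Context: $H,U$ are separable real Hilbert spaces. $\mathcal L(\cdot;\cdot)$ denotes bounded linear operators with the operator norm, $\mathcal L(H)=\mathcal L(H;H)$; $\Sigma(H)$ is the set of self-adjoint operators in $\mathcal L(H)$, $\Sigma^+(H)$ the set of nonnegative ones in $\Sigma(H)$ (similarly for $U$). Standing assumptions: $A:D(A)\subset H\to H$ is closed, densely defined and generates a $C_0$-semigroup $(e^{tA})_{t\ge0}$ on $H$; $B\in\mathcal L(U;H)$; $Q,Q_T\in\Sigma^+(H)$; $\overline Q,\overline Q_T\in\Sigma(H)$; $Q+\overline Q,\ Q_T+\overline Q_T\in\Sigma^+(H)$; $R\in\Sigma(U)$ with $\langle R\alpha,\alpha\rangle_U\ge\varepsilon|\alpha|_U^2$ for all $\alpha\in U$ and some $\varepsilon>0$; $S,S_T\in\mathcal L(H)$; $T>0$. $M\ge1$ and $\omega\in\mathbb R$ are such that $\|e^{tA}\|_{\mathcal L(H)}\le Me^{\omega t}$ for all $t\ge0$. $R(n,A)=(nI-A)^{-1}$ is the resolvent of $A$, and the index $n$ of the Yosida approximations $A_n\in\mathcal L(H)$ ranges over positive integers with $n>\omega$. $C_s([0,T];\Sigma^+(H))$ is the space of strongly continuous maps $f:[0,T]\to\Sigma^+(H)$, i.e. $t\mapsto f(t)x$ is continuous for each $x\in H$; $C^1_s([0,T];\Sigma(H))$ is the space of maps $f:[0,T]\to\Sigma(H)$ with $t\mapsto f(t)x$ of class $C^1$ for each $x\in H$. A strict solution $\eta_n$ of the equation in (H1) is such a map satisfying the terminal condition and,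 for all $t\in[0,T]$, $x\in H$, the equation applied to $x$, with $\eta_n'(t)x:=\frac{d}{dt}(\eta_n(t)x)$. Mild solution of the Riccati equation for $P$: $P\in C_s([0,T];\Sigma^+(H))$ such that for all $x\in H$, $t\in[0,T]$, $$P(t)x=e^{(T-t)A^*}(Q_T+\overline Q_T)e^{(T-t)A}x+\int_t^Te^{(s-t)A^*}(Q+\overline Q)e^{(s-t)A}x\,ds-\int_t^Te^{(s-t)A^*}P(s)BR^{-1}B^*P(s)e^{(s-t)A}x\,ds .$$ It is known that such a $P$ exists and is unique. *)

theory Defs
  imports "HOL-Analysis.Analysis"
begin

text \<open>
  A separable real Hilbert space is a type of sort
  \<open>{real_inner, banach, second_countable_topology}\<close>; for metric spaces second countability
  is separability.
\<close>

text \<open>For bounded operators between Hilbert spaces the library's \<^const>\<open>adjoint\<close> is again bounded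
  linear (Riesz), so that \<^const>\<open>Blinfun\<close> is applied inside its domain.\<close>

definition adj :: "('a::real_inner \<Rightarrow>\<^sub>L 'b::real_inner) \<Rightarrow> ('b \<Rightarrow>\<^sub>L 'a)" where
  "adj L = Blinfun (adjoint (blinfun_apply L))"

definition self_adjoint_ops :: "('a::real_inner \<Rightarrow>\<^sub>L 'a) set" where
  "self_adjoint_ops = {L. adj L = L}"

definition nonneg_ops :: "('a::real_inner \<Rightarrow>\<^sub>L 'a) set" where
  "nonneg_ops = {L \<in> self_adjoint_ops. \<forall>x. 0 \<le> L x \<bullet> x}"

text \<open>Only meaningful for a bijective operator, whose inverse is then bounded.\<close>

definition op_inverse :: "('a::banach \<Rightarrow>\<^sub>L 'a) \<Rightarrow> ('a \<Rightarrow>\<^sub>L 'a)" where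
  "op_inverse L = Blinfun (inv (blinfun_apply L))"

text \<open>An unbounded operator is given by its domain \<open>D\<close> and a function \<open>A\<close> of which only the values
  on \<open>D\<close> matter. Linearity is expressed by the graph being a subspace.\<close>

definition closed_densely_defined :: "'a::real_normed_vector set \<Rightarrow> ('a \<Rightarrow> 'a) \<Rightarrow> bool" where
  "closed_densely_defined D A \<longleftrightarrow>
     subspace ((\<lambda>x. (x, A x)) ` D) \<and> closed ((\<lambda>x. (x, A x)) ` D) \<and> closure D = UNIV"

text \<open>Only the values of \<open>E\<close> on \<open>[0,\<infinity>)\<close> matter.\<close>

definition C0_semigroup :: "(real \<Rightarrow> 'a::real_normed_vector \<Rightarrow>\<^sub>L 'a) \<Rightarrow> bool" where
  "C0_semigroup E \<longleftrightarrow>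
     E 0 = id_blinfun \<and>
     (\<forall>s\<ge>0. \<forall>t\<ge>0. E (s + t) = E s o\<^sub>L E t) \<and>
     (\<forall>x. continuous_on {0..} (\<lambda>t. E t x))"

definition generates :: "'a::real_normed_vector set \<Rightarrow> ('a \<Rightarrow> 'a) \<Rightarrow> (real \<Rightarrow> 'a \<Rightarrow>\<^sub>L 'a) \<Rightarrow> bool" where
  "generates D A E \<longleftrightarrow>
     C0_semigroup E \<and>
     D = {x. \<exists>y. ((\<lambda>h. (E h x - x) /\<^sub>R h) \<longlongrightarrow> y) (at_right 0)} \<and>
     (\<forall>x\<in>D. ((\<lambda>h. (E h x - x) /\<^sub>R h) \<longlongrightarrow> A x) (at_right 0))"

text \<open>Only meaningful for \<open>\<lambda>\<close> in the resolvent set, that is, when \<open>\<lambda> - A\<close> maps \<open>D\<close> bijectively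
  onto the space with bounded inverse.\<close>

definition resolvent :: "'a::real_normed_vector set \<Rightarrow> ('a \<Rightarrow> 'a) \<Rightarrow> real \<Rightarrow> ('a \<Rightarrow>\<^sub>L 'a)" where
  "resolvent D A l = Blinfun (the_inv_into D (\<lambda>x. l *\<^sub>R x - A x))"

definition yosida :: "'a::real_normed_vector set \<Rightarrow> ('a \<Rightarrow> 'a) \<Rightarrow> nat \<Rightarrow> ('a \<Rightarrow>\<^sub>L 'a)" where
  "yosida D A n = (real n)\<^sup>2 *\<^sub>R resolvent D A (real n) - real n *\<^sub>R id_blinfun"

definition Cs :: "real \<Rightarrow> ('a::real_normed_vector \<Rightarrow>\<^sub>L 'a) set \<Rightarrow> (real \<Rightarrow> 'a \<Rightarrow>\<^sub>L 'a) set" where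
  "Cs T X = {f. (\<forall>t\<in>{0..T}. f t \<in> X) \<and> (\<forall>x. continuous_on {0..T} (\<lambda>t. f t x))}"

text \<open>Derivatives are one-sided at the end points.\<close>

definition C1s :: "real \<Rightarrow> ('a::real_normed_vector \<Rightarrow>\<^sub>L 'a) set \<Rightarrow> (real \<Rightarrow> 'a \<Rightarrow>\<^sub>L 'a) set" where
  "C1s T X = {f. (\<forall>t\<in>{0..T}. f t \<in> X) \<and>
     (\<forall>x. \<exists>f'. continuous_on {0..T} f' \<and>
        (\<forall>t\<in>{0..T}. ((\<lambda>s. f s x) has_vector_derivative f' t) (at t within {0..T})))}"

text \<open>
  Mild solutions of \<open>P' + P A + A\<^sup>* P - P K P + C = 0\<close>, \<open>P(T) = C\<^sub>T\<close>, where \<open>E\<close> is the semigroup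
  generated by \<open>A\<close>; the semigroup generated by \<open>A\<^sup>*\<close> consists of the adjoints of \<open>E\<close>.
\<close>

definition mild_riccati ::
  "real \<Rightarrow> (real \<Rightarrow> 'a::{real_inner, banach} \<Rightarrow>\<^sub>L 'a) \<Rightarrow> ('a \<Rightarrow>\<^sub>L 'a) \<Rightarrow> ('a \<Rightarrow>\<^sub>L 'a) \<Rightarrow> ('a \<Rightarrow>\<^sub>L 'a) \<Rightarrow>
   (real \<Rightarrow> 'a \<Rightarrow>\<^sub>L 'a) \<Rightarrow> bool" where
  "mild_riccati T E K C C\<^sub>T P \<longleftrightarrow>
     P \<in> Cs T nonneg_ops \<and>
     (\<forall>x. \<forall>t\<in>{0..T}.
        P t x = adj (E (T - t)) (C\<^sub>T (E (T - t) x))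
          + integral {t..T} (\<lambda>s. adj (E (s - t)) (C (E (s - t) x)))
          - integral {t..T} (\<lambda>s. adj (E (s - t)) (P s (K (P s (E (s - t) x))))))"

text \<open>Strict solutions of
  \<open>\<eta>' = (P K - A\<^sup>*) \<eta> - \<eta> (A - K P) + C + \<eta> K \<eta>\<close>, \<open>\<eta>(T) = C\<^sub>T\<close>, for bounded \<open>A\<close>.\<close>

definition strict_eta_riccati ::
  "real \<Rightarrow> (real \<Rightarrow> 'a::real_inner \<Rightarrow>\<^sub>L 'a) \<Rightarrow> ('a \<Rightarrow>\<^sub>L 'a) \<Rightarrow> ('a \<Rightarrow>\<^sub>L 'a) \<Rightarrow> ('a \<Rightarrow>\<^sub>L 'a) \<Rightarrow>
   ('a \<Rightarrow>\<^sub>L 'a) \<Rightarrow> (real \<Rightarrow> 'a \<Rightarrow>\<^sub>L 'a) \<Rightarrow> bool" where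
  "strict_eta_riccati T P K A C C\<^sub>T \<eta> \<longleftrightarrow>
     \<eta> \<in> C1s T self_adjoint_ops \<and>
     \<eta> T = C\<^sub>T \<and>
     (\<forall>t\<in>{0..T}. \<forall>x.
        vector_derivative (\<lambda>s. \<eta> s x) (at t within {0..T}) =
          blinfun_apply
            ((((P t o\<^sub>L K) - adj A) o\<^sub>L \<eta> t) - (\<eta> t o\<^sub>L (A - (K o\<^sub>L P t))) + C
              + (\<eta> t o\<^sub>L K o\<^sub>L \<eta> t)) x)"

end

theory Submission
  imports Defs
begin

text \<open>
  With \<open>\<Theta> = A\<^sub>n - K P\<close>, \<open>C = - Qbar S\<close> and \<open>G = - Qbar\<^sub>T S\<^sub>T\<close> the equation reads
  \<open>\<eta>' + \<Theta>\<^sup>* \<eta> + \<eta> \<Theta> - \<eta> K \<eta> + C = 0\<close>, \<open>\<eta>(T) = G\<close>: a Riccati equation of control type whose data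
  \<open>K\<close>, \<open>C\<close>, \<open>G\<close> are all nonnegative. Two energy identities bound every solution.
  Along \<open>y' = (\<Theta> - K \<eta> / 2) y\<close> the quadratic term cancels, so that \<open>\<langle>\<eta> y, y\<rangle>\<close> decreases to
  \<open>\<langle>G y(T), y(T)\<rangle> \<ge> 0\<close>, and hence \<open>\<eta> \<ge> 0\<close>. Along \<open>y' = \<Theta> y\<close> the quadratic term has the good sign, so that
  \<open>\<langle>\<eta>(t) x, x\<rangle>\<close> is at most the linear cost \<open>\<langle>G y(T), y(T)\<rangle> + \<integral> \<langle>C y, y\<rangle>\<close> of the trajectory from \<open>x\<close>.
  Hence \<open>\<parallel>\<eta>(t)\<parallel> \<le> (\<parallel>G\<parallel> + T \<parallel>C\<parallel>) m\<^sup>2\<close> as soon as trajectories of \<open>y' = \<Theta> y\<close> grow at most by the factor \<open>m\<close>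
  (lemmas \<open>solution_nonneg\<close> and \<open>solution_bound\<close>).

  This a priori bound also gives existence. Replacing the factors of the quadratic term by their radial
  truncation makes the equation globally Lipschitz, and Picard iteration solves it on all of \<open>[0,T]\<close>.
  The truncated quadratic term is a scalar \<open>\<theta> \<ge> 0\<close> times the original one, so the energy estimates apply
  to it as well, and a large truncation radius is never reached (lemma \<open>solution_exists\<close>).
  Because \<open>P\<close> is only strongly continuous, the operator equation is integrated pointwise in \<open>x\<close>;
  the solutions are nevertheless Lipschitz in the operator norm.

  For the second claim, \<open>m\<close> must not depend on \<open>n\<close> (lemma \<open>yosida_propagator_uniform_bound\<close>). In the
  equivalent norm \<open>sup\<^sub>t e\<^bsup>-\<omega> t\<^esup> \<parallel>e\<^bsup>tA\<^esup> x\<parallel>\<close> the operator \<open>A - \<omega>\<close> is dissipative and \<open>R(n,A)\<close> has norm at most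
  \<open>1 / (n - \<omega>)\<close>. The growth rate of \<open>y' = A\<^sub>n y - K P y\<close> in that norm is therefore at most
  \<open>n\<^sup>2 / (n - \<omega>) - n = \<omega> + \<omega>\<^sup>2 / (n - \<omega>)\<close> plus a constant depending on \<open>K\<close> and \<open>P\<close>, and \<open>n - \<omega>\<close> stays away
  from zero as \<open>n\<close> ranges over the integers above \<open>\<omega>\<close>.
\<close>

section \<open>Adjoints and uniform boundedness in Hilbert spaces\<close>

text \<open>
  By Baire, one of the closed sets on which all operators are bounded by \<open>n\<close> has an interior point;
  the difference of two points of a ball inside it covers all directions.
\<close>
lemma uniform_boundedness:
  fixes F :: "'i \<Rightarrow> 'a::banach \<Rightarrow>\<^sub>L 'b::real_normed_vector"
  assumes pw: "\<And>x. \<exists>c. \<forall>i\<in>I. norm (F i x) \<le> c"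
  shows "\<exists>c\<ge>0. \<forall>i\<in>I. norm (F i) \<le> c"
proof -
  define C where "C n = {x. \<forall>i\<in>I. norm (F i x) \<le> real n}" for n
  have cl: "closed (C n)" for n
  proof -
    have "closed (\<Inter>i\<in>I. {x. norm (F i x) \<le> real n})"
      by (intro closed_INT ballI closed_Collect_le continuous_intros)
    moreover have "C n = (\<Inter>i\<in>I. {x. norm (F i x) \<le> real n})"
      by (auto simp: C_def)
    ultimately show ?thesis by simp
  qed
  have "x \<in> (\<Union>n. C n)" for x
  proof -
    obtain c where "\<forall>i\<in>I. norm (F i x) \<le> c" using pw by blast
    moreover obtain n where "c \<le> real n" using real_arch_simple by blast
    ultimately have "x \<in> C n" unfolding C_def by force
    thus ?thesis by blast
  qed
  hence un: "(\<Union>n. C n) = UNIV" by auto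
  have "\<exists>n. interior (C n) \<noteq> {}"
  proof (rule ccontr)
    assume "\<nexists>n. interior (C n) \<noteq> {}"
    hence "interior (\<Union>(range C)) = {}"
      using Baire_category_alt[of "euclidean :: 'a topology" "range C"] cl
      by (auto simp: completely_metrizable_space_euclidean)
    thus False using un by simp
  qed
  then obtain n x0 where "x0 \<in> interior (C n)" by blast
  then obtain r where r: "r > 0" "cball x0 r \<subseteq> C n"
    by (meson mem_interior_cball)
  have bd: "norm (F i x) \<le> (2 * real n / r) * norm x" if i: "i \<in> I" for i x
  proof (cases "x = 0")
    case False
    define y where "y = (r / norm x) *\<^sub>R x"
    have ny: "norm y = r" using False r by (simp add: y_def)
    have "x0 + y \<in> C n" "x0 \<in> C n" using r ny by (auto simp: dist_norm subset_iff)
    hence "norm (F i (x0 + y)) \<le> n" "norm (F i x0) \<le> n" using i by (auto simp: C_def)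
    moreover have "F i y = F i (x0 + y) - F i x0" by (simp add: blinfun.add_right)
    ultimately have "norm (F i y) \<le> 2 * real n"
      using norm_triangle_ineq4[of "F i (x0 + y)" "F i x0"] by simp
    thus ?thesis using False r by (simp add: y_def blinfun.scaleR_right field_simps)
  qed simp
  have "norm (F i) \<le> 2 * real n / r" if "i \<in> I" for i
    by (rule norm_blinfun_bound) (use bd[OF that] r in auto)
  thus ?thesis using r by (intro exI[of _ "2 * real n / r"]) auto
qed

text \<open>
  The solution is the minimiser of \<open>J x = \<langle>R x, x\<rangle> - 2 \<phi> x\<close>. The parallelogram identity for the form of \<open>R\<close>
  and coercivity make every minimising sequence Cauchy. The case \<open>R = id\<close> is the Riesz representation
  theorem, and the general case gives the surjectivity of a coercive self-adjoint operator.
\<close>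
lemma symmetric_coercive_solvable:
  fixes R :: "'a::{real_inner,banach} \<Rightarrow>\<^sub>L 'a" and \<phi> :: "'a \<Rightarrow>\<^sub>L real"
  assumes sym: "\<And>x y. R x \<bullet> y = x \<bullet> R y" and e: "0 < e"
    and coercive: "\<And>x. e * (norm x)\<^sup>2 \<le> R x \<bullet> x"
  shows "\<exists>z. \<forall>y. R z \<bullet> y = \<phi> y"
proof -
  define J where "J x = R x \<bullet> x - 2 * \<phi> x" for x
  define k where "k = norm \<phi>"
  have lower: "- k\<^sup>2 / e \<le> J x" for x
  proof -
    have "\<phi> x \<le> k * norm x" using norm_blinfun[of \<phi> x] by (simp add: k_def)
    hence "J x \<ge> e * (norm x)\<^sup>2 - 2 * (k * norm x)" using coercive[of x] by (simp add: J_def)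
    moreover have "0 \<le> (e * norm x - k)\<^sup>2" by simp
    ultimately have "e * J x \<ge> - k\<^sup>2"
      using e mult_left_mono[of "e * (norm x)\<^sup>2 - 2 * (k * norm x)" "J x" e]
      by (simp add: power2_eq_square algebra_simps)
    thus ?thesis using e by (simp add: field_simps)
  qed
  define m where "m = Inf (range J)"
  have bb: "bdd_below (range J)" using lower by (intro bdd_belowI2[of _ "- k\<^sup>2 / e"]) auto
  have m: "m \<le> J x" for x unfolding m_def by (rule cInf_lower) (use bb in auto)
  have "\<exists>x. J x < m + 1 / real (Suc n)" for n
    using cInf_lessD[of "range J" "m + 1 / real (Suc n)"] by (auto simp: m_def)
  then obtain x where x: "\<And>n. J (x n) < m + 1 / real (Suc n)" by metis
  have par: "e / 4 * (norm (u - v))\<^sup>2 \<le> (J u + J v) / 2 - m" for u v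
  proof -
    have "J ((1/2) *\<^sub>R (u + v)) = (J u + J v) / 2 - (R (u - v) \<bullet> (u - v)) / 4"
      using sym[of u v] by (simp add: J_def blinfun.bilinear_simps inner_simps inner_commute field_simps)
    with m[of "(1/2) *\<^sub>R (u + v)"] coercive[of "u - v"] show ?thesis by (simp add: field_simps)
  qed
  have "Cauchy x"
  proof (rule metric_CauchyI)
    fix d :: real assume d: "0 < d"
    obtain n0 where n0: "1 / real (Suc n0) < e / 4 * d\<^sup>2"
      using d e nat_approx_posE[of "e / 4 * d\<^sup>2"] by auto
    have "dist (x i) (x j) < d" if "i \<ge> n0" "j \<ge> n0" for i j
    proof -
      have "1 / real (Suc i) \<le> 1 / real (Suc n0)" "1 / real (Suc j) \<le> 1 / real (Suc n0)"
        using that by (auto intro!: divide_left_mono)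
      hence "J (x i) < m + e / 4 * d\<^sup>2" "J (x j) < m + e / 4 * d\<^sup>2"
        using x[of i] x[of j] n0 by linarith+
      hence "e / 4 * (norm (x i - x j))\<^sup>2 < e / 4 * d\<^sup>2"
        using par[of "x i" "x j"] by argo
      hence "(norm (x i - x j))\<^sup>2 < d\<^sup>2" using e by simp
      thus ?thesis using d by (simp add: dist_norm power_less_imp_less_base)
    qed
    thus "\<exists>M. \<forall>i\<ge>M. \<forall>j\<ge>M. dist (x i) (x j) < d" by blast
  qed
  then obtain z where z: "x \<longlonglongrightarrow> z" using Cauchy_convergent_iff convergent_def by blast
  have "(\<lambda>n. J (x n)) \<longlonglongrightarrow> J z" unfolding J_def by (intro tendsto_intros z)
  moreover have "(\<lambda>n. m + 1 / real (Suc n)) \<longlonglongrightarrow> m + 0"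
    by (intro tendsto_intros LIMSEQ_Suc[OF lim_1_over_n])
  ultimately have "J z \<le> m" using x by (intro LIMSEQ_le[of "\<lambda>n. J (x n)" "J z"]) (auto intro: less_imp_le)
  have "R z \<bullet> y = \<phi> y" for y
  proof (rule ccontr)
    assume neq: "R z \<bullet> y \<noteq> \<phi> y"
    define d q where "d = R z \<bullet> y - \<phi> y" and "q = R y \<bullet> y"
    have d0: "d\<^sup>2 > 0" using neq by (simp add: d_def)
    have q: "q \<ge> 0" using coercive[of y] e by (simp add: q_def) (meson mult_nonneg_nonneg less_imp_le order_trans zero_le_power2)
    \<comment> \<open>A step at which \<open>t\<^sup>2 q + 2 t d\<close> is negative; the \<open>+ 1\<close> avoids dividing by \<open>q = 0\<close>.\<close>
    define t where "t = - d / (q + 1)"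
    have "J (z + t *\<^sub>R y) = J z + (t\<^sup>2 * q + 2 * t * d)"
      using sym[of z y] by (simp add: J_def d_def q_def blinfun.bilinear_simps inner_simps inner_commute algebra_simps power2_eq_square)
    also have "t\<^sup>2 * q + 2 * t * d = - (d\<^sup>2 * (q + 2)) / (q + 1)\<^sup>2"
      using q by (simp add: t_def power2_eq_square divide_simps) (simp add: algebra_simps)
    also have "\<dots> < 0" using d0 q by (simp add: divide_simps)
    finally show False using m[of "z + t *\<^sub>R y"] \<open>J z \<le> m\<close> by linarith
  qed
  thus ?thesis by blast
qed

lemma riesz:
  fixes \<phi> :: "'a::{real_inner,banach} \<Rightarrow>\<^sub>L real"
  shows "\<exists>z. \<forall>y. z \<bullet> y = \<phi> y"
  using symmetric_coercive_solvable[of id_blinfun 1 \<phi>] by (simp add: power2_norm_eq_inner)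

lemma adj_apply:
  fixes L :: "'a::{real_inner,banach} \<Rightarrow>\<^sub>L 'b::real_inner"
  shows "x \<bullet> adj L y = L x \<bullet> y"
proof -
  have "\<exists>z. \<forall>x. x \<bullet> z = L x \<bullet> y" for y
    using riesz[of "blinfun_inner_left y o\<^sub>L L"] by (auto simp: blinfun_inner_left.rep_eq inner_commute)
  then obtain g where g: "\<And>x y. x \<bullet> g y = L x \<bullet> y" by metis
  have ad: "x \<bullet> adjoint L y = L x \<bullet> y" for x y
    unfolding adjoint_def by (rule someI2[of _ g]) (auto simp: g)
  have "bounded_linear (adjoint L)"
  proof (rule bounded_linear_intro[where K = "norm L"])
    show "adjoint L (u + v) = adjoint L u + adjoint L v" for u v
      by (subst vector_eq_ldot[symmetric]) (simp add: ad inner_simps)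
    show "adjoint L (c *\<^sub>R u) = c *\<^sub>R adjoint L u" for c u
      by (subst vector_eq_ldot[symmetric]) (simp add: ad inner_simps)
    show "norm (adjoint L u) \<le> norm u * norm L" for u
    proof (cases "adjoint L u = 0")
      case False
      have "norm (adjoint L u) * norm (adjoint L u) = L (adjoint L u) \<bullet> u"
        using ad[of "adjoint L u" u] by (simp add: power2_eq_square flip: power2_norm_eq_inner)
      also have "\<dots> \<le> norm L * norm (adjoint L u) * norm u"
        by (meson norm_blinfun norm_cauchy_schwarz mult_right_mono norm_ge_zero order_trans)
      finally show ?thesis using False by (simp add: mult.commute mult.left_commute)
    qed simp
  qed
  thus ?thesis by (simp add: adj_def bounded_linear_Blinfun_apply ad)
qed

lemma adj_eqI:
  fixes L :: "'a::{real_inner,banach} \<Rightarrow>\<^sub>L 'b::real_inner" and L' :: "'b \<Rightarrow>\<^sub>L 'a"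
  assumes "\<And>x y. x \<bullet> L' y = L x \<bullet> y"
  shows "adj L = L'"
  by (rule blinfun_eqI, subst vector_eq_ldot[symmetric]) (simp add: assms adj_apply)

lemma self_adjoint_ops_iff:
  fixes L :: "'a::{real_inner,banach} \<Rightarrow>\<^sub>L 'a"
  shows "L \<in> self_adjoint_ops \<longleftrightarrow> (\<forall>x y. L x \<bullet> y = x \<bullet> L y)"
  unfolding self_adjoint_ops_def using adj_apply[of _ L] adj_eqI[of L L] by auto

text \<open>
  The point is that \<^const>\<open>op_inverse\<close> is the true inverse of \<open>R\<close>. The form of the product at \<open>x\<close> is then
  \<open>\<langle>R v, v\<rangle>\<close> with \<open>v = R\<^bsup>-1\<^esup> B\<^sup>* x\<close>.
\<close>
lemma nonneg_control_weight:
  fixes B :: "'u::{real_inner,banach} \<Rightarrow>\<^sub>L 'h::{real_inner,banach}" and R :: "'u \<Rightarrow>\<^sub>L 'u"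
  assumes R: "R \<in> self_adjoint_ops" and e: "0 < e"
    and coercive: "\<And>a. e * (norm a)\<^sup>2 \<le> R a \<bullet> a"
  shows "B o\<^sub>L op_inverse R o\<^sub>L adj B \<in> nonneg_ops"
proof -
  have sym: "R x \<bullet> y = x \<bullet> R y" for x y using R self_adjoint_ops_iff by blast
  have nn: "0 \<le> R a \<bullet> a" for a
    using coercive[of a] e by (meson mult_nonneg_nonneg less_imp_le order_trans zero_le_power2)
  have below: "e * norm a \<le> norm (R a)" for a
  proof (cases "a = 0")
    case False
    have "e * (norm a)\<^sup>2 \<le> norm (R a) * norm a" using coercive[of a] norm_cauchy_schwarz[of "R a" a] by linarith
    thus ?thesis using False by (simp add: power2_eq_square)
  qed simp
  have "surj (blinfun_apply R)"
    unfolding surj_def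
  proof
    fix v :: 'u
    from symmetric_coercive_solvable[OF sym e coercive, of "blinfun_inner_right v"]
    obtain z where "\<forall>y. R z \<bullet> y = v \<bullet> y" by (auto simp: blinfun_inner_right.rep_eq)
    thus "\<exists>z. v = R z" using vector_eq_rdot[of "R z" v] by auto
  qed
  moreover have "inj (blinfun_apply R)"
  proof (rule injI)
    fix u v assume "R u = R v"
    hence "e * norm (u - v) \<le> 0" using below[of "u - v"] by (simp add: blinfun.diff_right)
    thus "u = v" using e by (simp add: mult_le_0_iff)
  qed
  ultimately have bij: "bij (blinfun_apply R)" by (simp add: bij_def)
  let ?i = "inv (blinfun_apply R)"
  have Ri: "R (?i v) = v" for v using bij by (simp add: bij_is_surj surj_f_inv_f)
  have iR: "?i (R v) = v" for v using bij by (simp add: bij_is_inj)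
  have "bounded_linear ?i"
  proof (rule bounded_linear_intro[where K = "1 / e"])
    show "?i (u + v) = ?i u + ?i v" for u v
      by (metis Ri iR blinfun.add_right)
    show "?i (c *\<^sub>R u) = c *\<^sub>R ?i u" for c u
      by (metis Ri iR blinfun.scaleR_right)
    show "norm (?i u) \<le> norm u * (1 / e)" for u
      using below[of "?i u"] e by (simp add: Ri field_simps)
  qed
  hence opi: "op_inverse R v = ?i v" for v by (simp add: op_inverse_def bounded_linear_Blinfun_apply)
  have adB: "adj B v \<bullet> u = v \<bullet> B u" for u v using adj_apply[of u B v] by (simp add: inner_commute)
  have K: "(B o\<^sub>L op_inverse R o\<^sub>L adj B) x \<bullet> y = ?i (adj B x) \<bullet> adj B y" for x y
    by (simp add: opi adj_apply)
  have isym: "?i u \<bullet> v = u \<bullet> ?i v" for u v using sym[of "?i u" "?i v"] by (simp add: Ri)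
  show ?thesis unfolding nonneg_ops_def mem_Collect_eq self_adjoint_ops_iff
  proof (intro conjI allI)
    fix x y
    show "(B o\<^sub>L op_inverse R o\<^sub>L adj B) x \<bullet> y = x \<bullet> (B o\<^sub>L op_inverse R o\<^sub>L adj B) y"
      using K[of x y] K[of y x] isym by (metis inner_commute)
    show "0 \<le> (B o\<^sub>L op_inverse R o\<^sub>L adj B) x \<bullet> x"
      using K[of x x] nn[of "?i (adj B x)"] by (simp add: Ri inner_commute)
  qed
qed

section \<open>Gronwall's lemma and calculus in the strong operator topology\<close>

lemma vector_derivative_mono:
  fixes f g :: "real \<Rightarrow> real"
  assumes "a \<le> b"
    and f: "\<And>x. x \<in> {a..b} \<Longrightarrow> (f has_vector_derivative f' x) (at x within {a..b})"
    and g: "\<And>x. x \<in> {a..b} \<Longrightarrow> (g has_vector_derivative g' x) (at x within {a..b})"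
    and le: "\<And>x. x \<in> {a..b} \<Longrightarrow> f' x \<le> g' x"
  shows "f b - f a \<le> g b - g a"
  by (rule has_integral_le[OF fundamental_theorem_of_calculus[OF assms(1) f]
        fundamental_theorem_of_calculus[OF assms(1) g] le]) auto

lemma norm_diff_le_derivative_bound:
  fixes f :: "real \<Rightarrow> 'a::banach"
  assumes f: "\<And>x. x \<in> {a..b} \<Longrightarrow> (f has_vector_derivative f' x) (at x within {a..b})"
    and B: "0 \<le> B" "\<And>x. x \<in> {a..b} \<Longrightarrow> norm (f' x) \<le> B"
    and st: "s \<in> {a..b}" "t \<in> {a..b}"
  shows "norm (f t - f s) \<le> B * \<bar>t - s\<bar>"
proof -
  have *: "norm (f v - f u) \<le> B * (v - u)" if uv: "u \<in> {a..b}" "v \<in> {a..b}" "u \<le> v" for u v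
  proof -
    have "(f' has_integral (f v - f u)) {u..v}"
      using uv by (intro fundamental_theorem_of_calculus has_vector_derivative_within_subset[OF f]) auto
    from has_integral_bound[OF B(1) this[folded box_real(2)]] show ?thesis
      using uv B(2) by auto
  qed
  show ?thesis using *[of s t] *[of t s] st by (cases "s \<le> t") (auto simp: norm_minus_commute)
qed

text \<open>
  The right-hand side of the hypothesis, multiplied by \<open>exp (- c (s - a))\<close>, is nonincreasing in \<open>s\<close>.
\<close>
lemma gronwall:
  fixes f :: "real \<Rightarrow> real"
  assumes f: "continuous_on {a..b} f" and c: "0 \<le> c"
    and le: "\<And>s. s \<in> {a..b} \<Longrightarrow> f s \<le> m + c * integral {a..s} f"
    and s: "s \<in> {a..b}"
  shows "f s \<le> m * exp (c * (s - a))"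
proof -
  define I where "I u = integral {a..u} f" for u
  define g where "g u = exp (- c * (u - a)) * (m + c * I u)" for u
  define g' where "g' u = exp (- c * (u - a)) * (c * f u - c * (m + c * I u))" for u
  have "(I has_vector_derivative f u) (at u within {a..s})" if "u \<in> {a..s}" for u
    unfolding I_def using that s
    by (intro integral_has_vector_derivative continuous_on_subset[OF f]) auto
  hence "(I has_real_derivative f u) (at u within {a..s})" if "u \<in> {a..s}" for u
    using that by (simp add: has_real_derivative_iff_has_vector_derivative)
  hence "(g has_vector_derivative g' u) (at u within {a..s})" if "u \<in> {a..s}" for u
    unfolding g_def has_real_derivative_iff_has_vector_derivative[symmetric] g'_def
    using that by (auto intro!: derivative_eq_intros simp: algebra_simps)
  moreover have "g' u \<le> 0" if "u \<in> {a..s}" for u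
  proof -
    have "c * f u \<le> c * (m + c * I u)" using le[of u] that s c by (intro mult_left_mono) (auto simp: I_def)
    thus ?thesis by (simp add: g'_def mult_nonneg_nonpos)
  qed
  ultimately have "g s - g a \<le> (\<lambda>_. 0) s - (\<lambda>_. 0::real) a"
    using s by (intro vector_derivative_mono[where f' = g' and g' = "\<lambda>_. 0"]) (auto intro!: derivative_eq_intros)
  hence "exp (- c * (s - a)) * (m + c * I s) \<le> m" by (simp add: g_def I_def)
  hence "exp (c * (s - a)) * (exp (- c * (s - a)) * (m + c * I s)) \<le> exp (c * (s - a)) * m"
    by (intro mult_left_mono) auto
  hence "m + c * I s \<le> exp (c * (s - a)) * m" by (simp add: mult.assoc[symmetric] exp_add[symmetric])
  thus ?thesis using le[OF s] by (simp add: I_def mult.commute)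
qed

lemma has_vector_derivative_iff_quotient:
  "(f has_vector_derivative D) (at x within S) \<longleftrightarrow> ((\<lambda>y. (f y - f x) /\<^sub>R (y - x)) \<longlongrightarrow> D) (at x within S)"
proof -
  have "norm ((1 / norm (y - x)) *\<^sub>R (f y - (f x + (y - x) *\<^sub>R D))) = norm ((f y - f x) /\<^sub>R (y - x) - D)"
    if "y \<noteq> x" for y
  proof -
    have "(1 / (y - x)) *\<^sub>R (f y - (f x + (y - x) *\<^sub>R D))
        = (1 / (y - x)) *\<^sub>R (f y - f x) - (1 / (y - x)) *\<^sub>R ((y - x) *\<^sub>R D)"
      by (simp only: scaleR_diff_right[symmetric] diff_diff_eq)
    hence "(f y - f x) /\<^sub>R (y - x) - D = (1 / (y - x)) *\<^sub>R (f y - (f x + (y - x) *\<^sub>R D))"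
      using that by (simp add: divide_inverse)
    thus ?thesis by simp
  qed
  hence "((\<lambda>y. norm ((1 / norm (y - x)) *\<^sub>R (f y - (f x + (y - x) *\<^sub>R D)))) \<longlongrightarrow> 0) (at x within S) \<longleftrightarrow>
    ((\<lambda>y. norm ((f y - f x) /\<^sub>R (y - x) - D)) \<longlongrightarrow> 0) (at x within S)"
    by (intro Lim_cong_within) auto
  hence "((\<lambda>y. (1 / norm (y - x)) *\<^sub>R (f y - (f x + (y - x) *\<^sub>R D))) \<longlongrightarrow> 0) (at x within S) \<longleftrightarrow>
    ((\<lambda>y. (f y - f x) /\<^sub>R (y - x)) \<longlongrightarrow> D) (at x within S)"
    unfolding tendsto_norm_zero_iff LIM_zero_iff .
  thus ?thesis unfolding has_vector_derivative_def has_derivative_within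
    using bounded_linear_scaleR_left by blast
qed

text \<open>
  Evaluation is jointly continuous for the strong topology on norm-bounded families, which is why
  norm bounds on strongly continuous families are needed throughout.
\<close>
lemma strong_tendsto:
  fixes F :: "'c \<Rightarrow> 'a::real_normed_vector \<Rightarrow>\<^sub>L 'b::real_normed_vector"
  assumes "\<forall>\<^sub>F s in net. norm (F s) \<le> m" and "((\<lambda>s. F s v) \<longlongrightarrow> L) net" and "(w \<longlongrightarrow> v) net"
  shows "((\<lambda>s. F s (w s)) \<longlongrightarrow> L) net"
proof -
  have "((\<lambda>s. w s - v) \<longlongrightarrow> 0) net" using assms(3) by (simp add: LIM_zero_iff)
  hence "((\<lambda>s. m * norm (w s - v)) \<longlongrightarrow> 0) net"
    by (intro tendsto_mult_right_zero tendsto_norm_zero)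
  moreover have "\<forall>\<^sub>F s in net. norm (F s (w s - v)) \<le> m * norm (w s - v)"
    using assms(1) by eventually_elim (meson norm_blinfun mult_right_mono norm_ge_zero order_trans)
  ultimately have "((\<lambda>s. F s (w s - v)) \<longlongrightarrow> 0) net" by (rule Lim_null_comparison[rotated])
  from tendsto_add[OF this assms(2)] show ?thesis by (simp add: blinfun.diff_right)
qed

lemma strong_continuous_on:
  fixes F :: "real \<Rightarrow> 'a::real_normed_vector \<Rightarrow>\<^sub>L 'b::real_normed_vector"
  assumes "\<And>s. s \<in> S \<Longrightarrow> norm (F s) \<le> m" and "\<And>x. continuous_on S (\<lambda>s. F s x)" and "continuous_on S w"
  shows "continuous_on S (\<lambda>s. F s (w s))"
  unfolding continuous_on_def
proof
  fix t assume t: "t \<in> S"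
  show "((\<lambda>s. F s (w s)) \<longlongrightarrow> F t (w t)) (at t within S)"
  proof (rule strong_tendsto)
    show "\<forall>\<^sub>F s in at t within S. norm (F s) \<le> m" using assms(1) by (simp add: eventually_at_filter)
    show "((\<lambda>s. F s (w t)) \<longlongrightarrow> F t (w t)) (at t within S)"
      using assms(2)[of "w t"] t unfolding continuous_on_def by blast
    show "(w \<longlongrightarrow> w t) (at t within S)" using assms(3) t unfolding continuous_on_def by blast
  qed
qed

lemma strong_product_rule:
  fixes F :: "real \<Rightarrow> 'a::real_normed_vector \<Rightarrow>\<^sub>L 'b::real_normed_vector"
  assumes bd: "\<And>s. s \<in> S \<Longrightarrow> norm (F s) \<le> m" and t: "t \<in> S"
    and F: "((\<lambda>s. F s (y t)) has_vector_derivative F') (at t within S)"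
    and y: "(y has_vector_derivative y') (at t within S)"
    and cont: "\<And>x. continuous_on S (\<lambda>s. F s x)"
  shows "((\<lambda>s. F s (y s)) has_vector_derivative (F' + F t y')) (at t within S)"
proof -
  have "((\<lambda>s. F s ((y s - y t) /\<^sub>R (s - t))) \<longlongrightarrow> F t y') (at t within S)"
  proof (rule strong_tendsto)
    show "\<forall>\<^sub>F s in at t within S. norm (F s) \<le> m" using bd by (simp add: eventually_at_filter)
    show "((\<lambda>s. F s y') \<longlongrightarrow> F t y') (at t within S)" using cont[of y'] t unfolding continuous_on_def by blast
    show "((\<lambda>s. (y s - y t) /\<^sub>R (s - t)) \<longlongrightarrow> y') (at t within S)"
      using y by (simp add: has_vector_derivative_iff_quotient)
  qed
  from tendsto_add[OF F[unfolded has_vector_derivative_iff_quotient] this] show ?thesis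
    unfolding has_vector_derivative_iff_quotient
    by (simp add: blinfun.bilinear_simps algebra_simps)
qed

section \<open>Differential equations for strongly continuous operator families\<close>

text \<open>
  The iterates \<open>\<phi> k\<close> satisfy \<open>\<parallel>\<phi> (k + 1) s - \<phi> k s\<parallel> \<le> m (c (s - a))\<^sup>k / k!\<close>, so they converge uniformly on the whole
  interval, however large the Lipschitz constant is. The closed set \<open>Z\<close> carries invariants such as
  self-adjointness from the iterates to the fixed point.
\<close>
lemma volterra_fixpoint:
  fixes \<Psi> :: "(real \<Rightarrow> 'b::banach) \<Rightarrow> real \<Rightarrow> 'b"
  assumes ab: "a \<le> b" and c: "0 \<le> c" and Z: "closed Z" "z0 \<in> Z"
    and cont: "\<And>F. continuous_on {a..b} F \<Longrightarrow> (\<And>s. s \<in> {a..b} \<Longrightarrow> F s \<in> Z) \<Longrightarrow> continuous_on {a..b} (\<Psi> F)"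
    and inv: "\<And>F s. continuous_on {a..b} F \<Longrightarrow> (\<And>s. s \<in> {a..b} \<Longrightarrow> F s \<in> Z) \<Longrightarrow> s \<in> {a..b} \<Longrightarrow> \<Psi> F s \<in> Z"
    and lip: "\<And>F G s. continuous_on {a..b} F \<Longrightarrow> continuous_on {a..b} G \<Longrightarrow>
      (\<And>s. s \<in> {a..b} \<Longrightarrow> F s \<in> Z) \<Longrightarrow> (\<And>s. s \<in> {a..b} \<Longrightarrow> G s \<in> Z) \<Longrightarrow> s \<in> {a..b} \<Longrightarrow>
      norm (\<Psi> F s - \<Psi> G s) \<le> c * integral {a..s} (\<lambda>r. norm (F r - G r))"
  shows "\<exists>F. continuous_on {a..b} F \<and> (\<forall>s\<in>{a..b}. F s \<in> Z \<and> F s = \<Psi> F s)"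
proof -
  define \<phi> where "\<phi> k = (\<Psi> ^^ k) (\<lambda>_. z0)" for k
  have \<phi>Suc: "\<phi> (Suc k) = \<Psi> (\<phi> k)" for k by (simp add: \<phi>_def)
  have \<phi>: "continuous_on {a..b} (\<phi> k)" "s \<in> {a..b} \<Longrightarrow> \<phi> k s \<in> Z" for k s
  proof (induction k arbitrary: s)
    case 0
    { case 1 show ?case by (simp add: \<phi>_def) }
    { case 2 thus ?case using Z by (simp add: \<phi>_def) }
  next
    case (Suc k)
    { case 1 show ?case unfolding \<phi>Suc by (rule cont) (use Suc in auto) }
    { case 2 thus ?case unfolding \<phi>Suc by (intro inv) (use Suc in auto) }
  qed
  have "bounded ((\<lambda>s. \<phi> 1 s - \<phi> 0 s) ` {a..b})"
    by (intro compact_imp_bounded compact_continuous_image continuous_intros \<phi>) auto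
  then obtain m where "\<forall>y\<in>(\<lambda>s. \<phi> 1 s - \<phi> 0 s) ` {a..b}. norm y \<le> m"
    unfolding bounded_iff by (rule exE)
  hence m: "norm (\<phi> 1 s - \<phi> 0 s) \<le> m" if "s \<in> {a..b}" for s
    using that by simp
  have m0: "0 \<le> m" using m[of a] ab order_trans[OF norm_ge_zero] by simp
  have step: "norm (\<phi> (Suc k) s - \<phi> k s) \<le> m * (c * (s - a)) ^ k / fact k" if "s \<in> {a..b}" for k s
    using that
  proof (induction k arbitrary: s)
    case (Suc k)
    define h where "h r = m * (c * (r - a)) ^ k / fact k" for r
    define H where "H r = m * c ^ k * (r - a) ^ Suc k / fact (Suc k)" for r
    have "(H has_vector_derivative h r) (at r within {a..s})" for r
    proof -
      have "(H has_real_derivative m * c ^ k * (real (Suc k) * (r - a) ^ k) / fact (Suc k)) (at r within {a..s})"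
        unfolding H_def by (rule derivative_eq_intros refl | simp)+
      moreover have "m * c ^ k * (real (Suc k) * (r - a) ^ k) / fact (Suc k) = h r"
        by (simp add: h_def power_mult_distrib del: of_nat_Suc)
      ultimately show ?thesis by (simp add: has_real_derivative_iff_has_vector_derivative)
    qed
    hence hi: "(h has_integral (H s - H a)) {a..s}" using Suc.prems by (intro fundamental_theorem_of_calculus) auto
    have "norm (\<Psi> (\<phi> (Suc k)) s - \<Psi> (\<phi> k) s) \<le> c * integral {a..s} (\<lambda>r. norm (\<phi> (Suc k) r - \<phi> k r))"
      by (rule lip) (use Suc.prems \<phi> in auto)
    hence "norm (\<phi> (Suc (Suc k)) s - \<phi> (Suc k) s) \<le> c * integral {a..s} (\<lambda>r. norm (\<phi> (Suc k) r - \<phi> k r))"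
      by (simp only: \<phi>Suc)
    also have "\<dots> \<le> c * integral {a..s} h"
    proof (intro mult_left_mono[OF _ c] integral_le)
      show "(\<lambda>r. norm (\<phi> (Suc k) r - \<phi> k r)) integrable_on {a..s}"
        by (intro integrable_continuous_real continuous_intros continuous_on_subset[OF \<phi>(1)]) (use Suc.prems in auto)
      show "norm (\<phi> (Suc k) r - \<phi> k r) \<le> h r" if "r \<in> {a..s}" for r
        unfolding h_def using Suc.IH[of r] Suc.prems that by auto
    qed (use hi in auto)
    also have "integral {a..s} h = H s" using hi by (simp add: H_def integral_unique)
    also have "c * H s = m * (c * (s - a)) ^ Suc k / fact (Suc k)"
      by (simp add: H_def power_mult_distrib)
    finally show ?case .
  qed (use m in auto)
  define M where "M k = m * ((c * (b - a)) ^ k / fact k)" for k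
  have "summable M" unfolding M_def
    using summable_exp_generic[of "c * (b - a)"] by (intro summable_mult) (simp add: divide_inverse mult.commute)
  moreover have "norm (\<phi> (Suc k) s - \<phi> k s) \<le> M k" if "s \<in> {a..b}" for k s
  proof -
    have "m * ((c * (s - a)) ^ k / fact k) \<le> M k" unfolding M_def using that c m0
      by (intro mult_left_mono divide_right_mono power_mono) auto
    with step[OF that, of k] show ?thesis by simp
  qed
  ultimately have ul0: "uniform_limit {a..b} (\<lambda>n s. \<Sum>k<n. \<phi> (Suc k) s - \<phi> k s)
     (\<lambda>s. \<Sum>k. \<phi> (Suc k) s - \<phi> k s) sequentially"
    by (intro Weierstrass_m_test) auto
  define F where "F s = z0 + (\<Sum>k. \<phi> (Suc k) s - \<phi> k s)" for s
  have tel: "\<phi> n s = z0 + (\<Sum>k<n. \<phi> (Suc k) s - \<phi> k s)" for n s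
    by (subst sum_lessThan_telescope) (simp add: \<phi>_def)
  have ul: "uniform_limit {a..b} \<phi> F sequentially"
  proof -
    have "uniform_limit {a..b} (\<lambda>n s. z0 + (\<Sum>k<n. \<phi> (Suc k) s - \<phi> k s)) F sequentially"
      unfolding F_def by (intro uniform_limit_add uniform_limit_const ul0)
    thus ?thesis using tel by (metis (no_types, lifting) ext)
  qed
  have Fc: "continuous_on {a..b} F"
    by (rule uniform_limit_theorem[OF _ ul]) (use \<phi> in auto)
  have FZ: "F s \<in> Z" if "s \<in> {a..b}" for s
    using closed_sequentially[OF Z(1), of "\<lambda>n. \<phi> n s"] \<phi>(2)[OF that] tendsto_uniform_limitI[OF ul that] by blast
  have "F s = \<Psi> F s" if s: "s \<in> {a..b}" for s
  proof (rule ccontr)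
    assume neq: "F s \<noteq> \<Psi> F s"
    define q where "q = 1 + c * (b - a)"
    have q: "q > 0" using ab c unfolding q_def by (smt (verit) mult_nonneg_nonneg)
    define e where "e = norm (F s - \<Psi> F s) / (2 * q)"
    have e: "e > 0" using neq q by (simp add: e_def)
    obtain n0 where n0: "\<And>n r. n \<ge> n0 \<Longrightarrow> r \<in> {a..b} \<Longrightarrow> dist (\<phi> n r) (F r) < e"
      using uniform_limitD[OF ul e] unfolding eventually_sequentially by blast
    have "norm (\<Psi> (\<phi> n0) s - \<Psi> F s) \<le> c * integral {a..s} (\<lambda>r. norm (\<phi> n0 r - F r))"
      by (rule lip) (use \<phi> Fc FZ s in auto)
    also have "\<dots> \<le> c * (e * (b - a))"
    proof (intro mult_left_mono[OF _ c])
      have "integral {a..s} (\<lambda>r. norm (\<phi> n0 r - F r)) \<le> integral {a..s} (\<lambda>r. e)"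
      proof (intro integral_le)
        show "(\<lambda>r. norm (\<phi> n0 r - F r)) integrable_on {a..s}"
          by (intro integrable_continuous_real continuous_intros continuous_on_subset[OF \<phi>(1)]
                continuous_on_subset[OF Fc]) (use s in auto)
        show "norm (\<phi> n0 r - F r) \<le> e" if "r \<in> {a..s}" for r
          using n0[of n0 r] that s by (auto simp: dist_norm)
      qed auto
      also have "\<dots> = e * (s - a)" using s by simp
      also have "\<dots> \<le> e * (b - a)" using s e by simp
      finally show "integral {a..s} (\<lambda>r. norm (\<phi> n0 r - F r)) \<le> e * (b - a)" .
    qed
    finally have "norm (\<phi> (Suc n0) s - \<Psi> F s) \<le> c * (e * (b - a))" by (simp add: \<phi>Suc)
    moreover have "norm (F s - \<phi> (Suc n0) s) \<le> e"
      using n0[of "Suc n0" s] s by (simp add: dist_norm norm_minus_commute)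
    ultimately have "norm (F s - \<Psi> F s) \<le> e + c * (e * (b - a))"
      using norm_triangle_ineq[of "F s - \<phi> (Suc n0) s" "\<phi> (Suc n0) s - \<Psi> F s"] by simp
    also have "\<dots> = e * q" by (simp add: q_def algebra_simps)
    also have "\<dots> = norm (F s - \<Psi> F s) / 2" using q by (simp add: e_def)
    finally show False using neq by simp
  qed
  thus ?thesis using Fc FZ by blast
qed

lemma strongly_continuous_bounded:
  fixes H :: "real \<Rightarrow> 'a::banach \<Rightarrow>\<^sub>L 'b::real_normed_vector"
  assumes "\<And>x. continuous_on {a..b} (\<lambda>r. H r x)"
  shows "\<exists>m\<ge>0. \<forall>r\<in>{a..b}. norm (H r) \<le> m"
proof (rule uniform_boundedness)
  fix x
  have "bounded ((\<lambda>r. H r x) ` {a..b})"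
    by (intro compact_imp_bounded compact_continuous_image assms) auto
  thus "\<exists>c. \<forall>r\<in>{a..b}. norm (H r x) \<le> c" by (auto simp: bounded_iff)
qed

lemma strong_integral_exists:
  fixes H :: "real \<Rightarrow> 'a::banach \<Rightarrow>\<^sub>L 'b::banach"
  assumes H: "\<And>x. continuous_on {a..b} (\<lambda>r. H r x)" and s: "s \<in> {a..b}"
  shows "\<exists>L::'a \<Rightarrow>\<^sub>L 'b. \<forall>x. L x = integral {a..s} (\<lambda>r. H r x)"
proof -
  obtain m where m: "m \<ge> 0" "\<And>r. r \<in> {a..b} \<Longrightarrow> norm (H r) \<le> m"
    using strongly_continuous_bounded[of a b H] H by blast
  have cont: "continuous_on {a..s} (\<lambda>r. H r x)" for x by (rule continuous_on_subset[OF H]) (use s in auto)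
  have int: "(\<lambda>r. H r x) integrable_on {a..s}" for x by (intro integrable_continuous_real cont)
  have "bounded_linear (\<lambda>x. integral {a..s} (\<lambda>r. H r x))"
  proof (rule bounded_linear_intro[where K = "m * (s - a)"])
    show "integral {a..s} (\<lambda>r. H r (x + y)) = integral {a..s} (\<lambda>r. H r x) + integral {a..s} (\<lambda>r. H r y)" for x y
      by (simp add: blinfun.add_right integral_add int)
    show "integral {a..s} (\<lambda>r. H r (k *\<^sub>R x)) = k *\<^sub>R integral {a..s} (\<lambda>r. H r x)" for k x
      by (simp add: blinfun.scaleR_right)
    show "norm (integral {a..s} (\<lambda>r. H r x)) \<le> norm x * (m * (s - a))" for x
    proof -
      have "norm (H r x) \<le> m * norm x" if "r \<in> {a..s}" for r
        using m(2)[of r] that s norm_blinfun[of "H r" x] by (smt (verit) atLeastAtMost_iff mult_right_mono norm_ge_zero)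
      from integral_bound[OF _ cont this] s show ?thesis by (simp add: mult.commute mult.left_commute)
    qed
  qed
  thus ?thesis by (metis bounded_linear_Blinfun_apply)
qed

text \<open>
  The right-hand side \<open>r \<mapsto> f r (F r)\<close> is continuous only after evaluation at a vector, so it has no integral
  in the operator norm. Integrating pointwise in \<open>x\<close> gives a bounded operator by uniform boundedness, and its
  dependence on the upper limit is Lipschitz in norm, which gives the norm continuity needed for the fixed point argument.
\<close>
lemma strong_operator_ode:
  fixes f :: "real \<Rightarrow> ('a::banach \<Rightarrow>\<^sub>L 'b::banach) \<Rightarrow> ('a \<Rightarrow>\<^sub>L 'b)"
  assumes ab: "a \<le> b" and c: "0 \<le> c" and Z: "closed Z" "G \<in> Z"
    and cont: "\<And>F x. continuous_on {a..b} F \<Longrightarrow> continuous_on {a..b} (\<lambda>r. f r (F r) x)"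
    and lip: "\<And>r X Y. r \<in> {a..b} \<Longrightarrow> norm (f r X - f r Y) \<le> c * norm (X - Y)"
    and inv: "\<And>r X. r \<in> {a..b} \<Longrightarrow> X \<in> Z \<Longrightarrow> f r X \<in> Z"
    and int: "\<And>H L s. s \<in> {a..b} \<Longrightarrow> (\<And>r. r \<in> {a..b} \<Longrightarrow> H r \<in> Z) \<Longrightarrow>
      (\<And>x. ((\<lambda>r. blinfun_apply (H r) x) has_integral (blinfun_apply L x - G x)) {a..s}) \<Longrightarrow> L \<in> Z"
  shows "\<exists>F. continuous_on {a..b} F \<and> F a = G \<and> (\<forall>s\<in>{a..b}. F s \<in> Z) \<and>
    (\<forall>s\<in>{a..b}. \<forall>x. ((\<lambda>s. F s x) has_vector_derivative f s (F s) x) (at s within {a..b}))"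
proof -
  have "\<exists>L::'a \<Rightarrow>\<^sub>L 'b. \<forall>x. L x = integral {a..s} (\<lambda>r. f r (F r) x)"
    if "continuous_on {a..b} F" "s \<in> {a..b}" for F s
    using strong_integral_exists[of a b "\<lambda>r. f r (F r)" s] cont[OF that(1)] that(2) by blast
  then obtain J where J: "\<And>F s x. continuous_on {a..b} F \<Longrightarrow> s \<in> {a..b} \<Longrightarrow>
      blinfun_apply (J F s) x = integral {a..s} (\<lambda>r. f r (F r) x)" by metis
  define \<Psi> where "\<Psi> F s = G + J F s" for F s
  have \<Psi>: "\<Psi> F s x = G x + integral {a..s} (\<lambda>r. f r (F r) x)" if "continuous_on {a..b} F" "s \<in> {a..b}" for F s x
    using J[OF that] by (simp add: \<Psi>_def blinfun.add_left)
  have contI: "continuous_on {a..s} (\<lambda>r. f r (F r) x)" if "continuous_on {a..b} F" "s \<in> {a..b}" for F s x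
    by (rule continuous_on_subset[OF cont[OF that(1)]]) (use that in auto)
  have deriv: "((\<lambda>s. \<Psi> F s x) has_vector_derivative f s (F s) x) (at s within {a..b})"
    if F: "continuous_on {a..b} F" and s: "s \<in> {a..b}" for F s x
  proof -
    have "((\<lambda>s. G x + integral {a..s} (\<lambda>r. f r (F r) x)) has_vector_derivative 0 + f s (F s) x) (at s within {a..b})"
      by (intro has_vector_derivative_add has_vector_derivative_const integral_has_vector_derivative cont F s)
    hence "((\<lambda>s. G x + integral {a..s} (\<lambda>r. f r (F r) x)) has_vector_derivative f s (F s) x) (at s within {a..b})"
      by simp
    thus ?thesis by (rule has_vector_derivative_transform[OF s, rotated]) (use \<Psi> F in auto)
  qed
  have "\<exists>F. continuous_on {a..b} F \<and> (\<forall>s\<in>{a..b}. F s \<in> Z \<and> F s = \<Psi> F s)"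
  proof (rule volterra_fixpoint[OF ab c Z])
    fix F :: "real \<Rightarrow> 'a \<Rightarrow>\<^sub>L 'b" assume F: "continuous_on {a..b} F" and FZ: "\<And>s. s \<in> {a..b} \<Longrightarrow> F s \<in> Z"
    obtain m where m: "m \<ge> 0" "\<And>r. r \<in> {a..b} \<Longrightarrow> norm (f r (F r)) \<le> m"
      using strongly_continuous_bounded[of a b "\<lambda>r. f r (F r)"] cont[OF F] by blast
    have "dist (\<Psi> F s) (\<Psi> F t) \<le> m * dist s t" if st: "s \<in> {a..b}" "t \<in> {a..b}" for s t
      unfolding dist_norm
    proof (rule norm_blinfun_bound)
      fix x
      have "norm (\<Psi> F s x - \<Psi> F t x) \<le> (m * norm x) * \<bar>s - t\<bar>"
      proof (rule norm_diff_le_derivative_bound[OF deriv[OF F] _ _ st(2,1)])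
        show "norm (f r (F r) x) \<le> m * norm x" if "r \<in> {a..b}" for r
          using m(2)[OF that] norm_blinfun[of "f r (F r)" x] by (smt (verit) mult_right_mono norm_ge_zero)
      qed (use m in auto)
      thus "norm ((\<Psi> F s - \<Psi> F t) x) \<le> m * norm (s - t) * norm x"
        by (simp add: blinfun.diff_left mult_ac)
    qed (use m in auto)
    hence "m-lipschitz_on {a..b} (\<Psi> F)" using m(1) by (intro lipschitz_onI) auto
    thus "continuous_on {a..b} (\<Psi> F)" by (rule lipschitz_on_continuous_on)
    fix s assume s: "s \<in> {a..b}"
    show "\<Psi> F s \<in> Z"
    proof (rule int[OF s])
      show "f r (F r) \<in> Z" if "r \<in> {a..b}" for r using inv FZ that by blast
      show "((\<lambda>r. f r (F r) x) has_integral (\<Psi> F s x - G x)) {a..s}" for x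
        using \<Psi>[OF F s, of x] integrable_continuous_real[OF contI[OF F s, of x]]
        by (simp add: integrable_integral)
    qed
  next
    fix F H :: "real \<Rightarrow> 'a \<Rightarrow>\<^sub>L 'b" and s assume F: "continuous_on {a..b} F" and H: "continuous_on {a..b} H" and s: "s \<in> {a..b}"
    have i: "(\<lambda>r. norm (F r - H r)) integrable_on {a..s}"
      by (intro integrable_continuous_real continuous_intros continuous_on_subset[OF F]
            continuous_on_subset[OF H]) (use s in auto)
    show "norm (\<Psi> F s - \<Psi> H s) \<le> c * integral {a..s} (\<lambda>r. norm (F r - H r))"
    proof (rule norm_blinfun_bound)
      show "0 \<le> c * integral {a..s} (\<lambda>r. norm (F r - H r))" by (intro mult_nonneg_nonneg c integral_nonneg i) auto
      fix x
      have "(\<Psi> F s - \<Psi> H s) x = integral {a..s} (\<lambda>r. f r (F r) x) - integral {a..s} (\<lambda>r. f r (H r) x)"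
        by (simp add: blinfun.diff_left \<Psi>[OF F s] \<Psi>[OF H s])
      also have "\<dots> = integral {a..s} (\<lambda>r. f r (F r) x - f r (H r) x)"
        by (rule integral_diff[symmetric]; intro integrable_continuous_real contI F H s)
      finally have "norm ((\<Psi> F s - \<Psi> H s) x) = norm (integral {a..s} (\<lambda>r. f r (F r) x - f r (H r) x))"
        by simp
      also have "\<dots> \<le> integral {a..s} (\<lambda>r. (c * norm x) * norm (F r - H r))"
      proof (rule integral_norm_bound_integral)
        show "(\<lambda>r. f r (F r) x - f r (H r) x) integrable_on {a..s}"
          by (intro integrable_diff integrable_continuous_real contI F H s)
        show "(\<lambda>r. (c * norm x) * norm (F r - H r)) integrable_on {a..s}"
          using integrable_on_cmult_left[OF i, of "c * norm x"] by simp
        fix r assume "r \<in> {a..s}"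
        hence "norm (f r (F r) - f r (H r)) * norm x \<le> c * norm (F r - H r) * norm x"
          using s by (intro mult_right_mono lip) auto
        thus "norm (f r (F r) x - f r (H r) x) \<le> (c * norm x) * norm (F r - H r)"
          using norm_blinfun[of "f r (F r) - f r (H r)" x] by (simp add: blinfun.diff_left mult_ac)
      qed
      finally show "norm ((\<Psi> F s - \<Psi> H s) x) \<le> c * integral {a..s} (\<lambda>r. norm (F r - H r)) * norm x"
        by (simp add: mult_ac)
    qed
  qed
  then obtain F where F: "continuous_on {a..b} F" "\<And>s. s \<in> {a..b} \<Longrightarrow> F s \<in> Z" "\<And>s. s \<in> {a..b} \<Longrightarrow> F s = \<Psi> F s"
    by blast
  have "((\<lambda>s. F s x) has_vector_derivative f s (F s) x) (at s within {a..b})" if s: "s \<in> {a..b}" for s x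
    by (rule has_vector_derivative_transform[OF s _ deriv[OF F(1) s]]) (use F(3) in auto)
  moreover have "F a = G"
    by (rule blinfun_eqI) (use F(3)[of a] \<Psi>[OF F(1), of a] ab in auto)
  ultimately show ?thesis using F by blast
qed

section \<open>Riccati equations with nonnegative data\<close>

text \<open>
  The trajectories are the columns of the operator equation with initial value the identity.
\<close>
lemma linear_evolution_exists:
  fixes L :: "real \<Rightarrow> 'a::banach \<Rightarrow>\<^sub>L 'a"
  assumes ab: "a \<le> b" and L: "\<And>x. continuous_on {a..b} (\<lambda>t. L t x)"
  shows "\<exists>y. y a = x \<and> (\<forall>s\<in>{a..b}. (y has_vector_derivative L s (y s)) (at s within {a..b}))"
proof -
  obtain m where m: "m \<ge> 0" "\<And>r. r \<in> {a..b} \<Longrightarrow> norm (L r) \<le> m"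
    using strongly_continuous_bounded[of a b L] L by blast
  have "\<exists>F. continuous_on {a..b} F \<and> F a = (id_blinfun :: 'a \<Rightarrow>\<^sub>L 'a) \<and> (\<forall>s\<in>{a..b}. F s \<in> UNIV) \<and>
    (\<forall>s\<in>{a..b}. \<forall>x. ((\<lambda>s. F s x) has_vector_derivative (L s o\<^sub>L F s) x) (at s within {a..b}))"
  proof (rule strong_operator_ode[OF ab m(1)])
    fix F :: "real \<Rightarrow> 'a \<Rightarrow>\<^sub>L 'a" and x assume F: "continuous_on {a..b} F"
    show "continuous_on {a..b} (\<lambda>r. (L r o\<^sub>L F r) x)"
      by (simp, rule strong_continuous_on[OF m(2) L]) (auto intro!: continuous_intros F)
  next
    fix r and X Y :: "'a \<Rightarrow>\<^sub>L 'a" assume r: "r \<in> {a..b}"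
    have "norm (L r o\<^sub>L (X - Y)) \<le> m * norm (X - Y)"
      using norm_blinfun_compose[of "L r" "X - Y"] m(2)[OF r] by (smt (verit) mult_right_mono norm_ge_zero)
    thus "norm ((L r o\<^sub>L X) - (L r o\<^sub>L Y)) \<le> m * norm (X - Y)" by (simp add: bounded_bilinear.diff_right[OF bounded_bilinear_blinfun_compose])
  qed auto
  then obtain F where "F a = (id_blinfun :: 'a \<Rightarrow>\<^sub>L 'a)"
    "\<forall>s\<in>{a..b}. \<forall>x. ((\<lambda>s. F s x) has_vector_derivative (L s o\<^sub>L F s) x) (at s within {a..b})" by blast
  thus ?thesis by (intro exI[of _ "\<lambda>s. F s x"]) auto
qed

text \<open>
  Polarisation: \<open>4 \<langle>F x, y\<rangle> = \<langle>F (x + y), x + y\<rangle> - \<langle>F (x - y), x - y\<rangle>\<close>, used for \<open>y\<close> parallel to \<open>F x\<close> and as long as \<open>x\<close>.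
\<close>
lemma norm_symmetric_le:
  fixes F :: "'a::real_inner \<Rightarrow>\<^sub>L 'a"
  assumes sym: "\<And>x y. F x \<bullet> y = x \<bullet> F y" and c: "0 \<le> c" and q: "\<And>x. \<bar>F x \<bullet> x\<bar> \<le> c * (norm x)\<^sup>2"
  shows "norm F \<le> c"
proof (rule norm_blinfun_bound[OF c])
  fix x
  show "norm (F x) \<le> c * norm x"
  proof (cases "F x = 0 \<or> x = 0")
    case False
    define y where "y = (norm x / norm (F x)) *\<^sub>R F x"
    have ny: "norm y = norm x" using False by (simp add: y_def)
    have "4 * (F x \<bullet> y) = F (x + y) \<bullet> (x + y) - F (x - y) \<bullet> (x - y)"
      using sym[of x y] by (simp add: blinfun.bilinear_simps inner_simps inner_commute)
    also have "\<dots> \<le> c * (norm (x + y))\<^sup>2 + c * (norm (x - y))\<^sup>2"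
      using q[of "x + y"] q[of "x - y"] by linarith
    also have "\<dots> = c * (2 * (norm x)\<^sup>2 + 2 * (norm y)\<^sup>2)"
      by (simp add: power2_norm_eq_inner inner_simps inner_commute algebra_simps)
    also have "\<dots> = 4 * (c * (norm x)\<^sup>2)" by (simp add: ny)
    finally have "F x \<bullet> y \<le> c * (norm x)\<^sup>2" by simp
    moreover have "F x \<bullet> y = norm x * norm (F x)"
      using False by (simp add: y_def power2_eq_square flip: power2_norm_eq_inner)
    ultimately have "norm x * norm (F x) \<le> norm x * (c * norm x)"
      by (simp add: power2_eq_square mult_ac)
    thus ?thesis using False by simp
  qed (use c in auto)
qed

lemma closed_self_adjoint_ops: "closed (self_adjoint_ops :: ('a::{real_inner,banach} \<Rightarrow>\<^sub>L 'a) set)"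
proof -
  have "self_adjoint_ops = {L :: 'a \<Rightarrow>\<^sub>L 'a. \<forall>x y. L x \<bullet> y = x \<bullet> L y}"
    using self_adjoint_ops_iff by blast
  moreover have "closed {L :: 'a \<Rightarrow>\<^sub>L 'a. \<forall>x y. L x \<bullet> y = x \<bullet> L y}"
    by (intro closed_Collect_all closed_Collect_eq continuous_intros)
  ultimately show ?thesis by simp
qed

text \<open>
  Radial retraction onto the ball of radius \<open>\<rho>\<close>; being a scalar multiple of \<open>X\<close>, it preserves self-adjointness.
\<close>
definition truncate :: "real \<Rightarrow> 'a::real_normed_vector \<Rightarrow> 'a" where
  "truncate \<rho> X = (\<rho> / max \<rho> (norm X)) *\<^sub>R X"

lemma norm_truncate: "0 < \<rho> \<Longrightarrow> norm (truncate \<rho> X) \<le> \<rho>"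
  by (auto simp: truncate_def divide_simps max_def)

lemma truncate_lipschitz:
  assumes \<rho>: "0 < \<rho>"
  shows "norm (truncate \<rho> X - truncate \<rho> Y) \<le> 2 * norm (X - Y)"
proof -
  define p q where "p = max \<rho> (norm X)" and "q = max \<rho> (norm Y)"
  have pq: "p \<ge> \<rho>" "q \<ge> \<rho>" "q \<ge> norm Y" "p > 0" "q > 0" using \<rho> by (auto simp: p_def q_def)
  have d: "\<bar>q - p\<bar> \<le> norm (X - Y)"
    using norm_triangle_ineq3[of X Y] by (auto simp: p_def q_def max_def)
  have "truncate \<rho> X - truncate \<rho> Y = (\<rho> / p) *\<^sub>R (X - Y) + (\<rho> / p - \<rho> / q) *\<^sub>R Y"
    by (simp add: truncate_def p_def q_def algebra_simps)
  also have "norm \<dots> \<le> \<rho> / p * norm (X - Y) + \<bar>\<rho> / p - \<rho> / q\<bar> * norm Y"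
    using norm_triangle_ineq pq \<rho> by (metis abs_of_nonneg divide_nonneg_pos less_imp_le norm_scaleR)
  also have "\<rho> / p * norm (X - Y) \<le> 1 * norm (X - Y)" using pq \<rho> by (intro mult_right_mono) auto
  also have "\<bar>\<rho> / p - \<rho> / q\<bar> * norm Y \<le> norm (X - Y)"
  proof -
    have "\<rho> / p - \<rho> / q = (\<rho> / p) * ((q - p) / q)" using pq by (simp add: field_simps)
    hence "\<bar>\<rho> / p - \<rho> / q\<bar> * norm Y = (\<rho> / p) * (norm Y / q) * \<bar>q - p\<bar>" using pq \<rho> by (simp add: abs_mult)
    also have "\<dots> \<le> 1 * \<bar>q - p\<bar>" using pq \<rho>
      by (intro mult_right_mono mult_le_one) auto
    finally show ?thesis using d by simp
  qed
  finally show ?thesis by simp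
qed

text \<open>
  Terminal value problem \<open>F' + L\<^sup>* F + F L - F K F + C = 0\<close>, \<open>F(T) = G\<close> with nonnegative data. Strong continuity
  does not pass to adjoints in general, so it is required of \<open>L\<close> and of \<open>L\<^sup>*\<close>.
\<close>
locale riccati =
  fixes T :: real and L :: "real \<Rightarrow> 'a::{real_inner,banach} \<Rightarrow>\<^sub>L 'a" and K C G :: "'a \<Rightarrow>\<^sub>L 'a"
  assumes T: "0 < T"
    and L: "\<And>x. continuous_on {0..T} (\<lambda>t. L t x)"
    and L_adj: "\<And>x. continuous_on {0..T} (\<lambda>t. adj (L t) x)"
    and K: "K \<in> nonneg_ops" and C: "C \<in> nonneg_ops" and G: "G \<in> nonneg_ops"
begin

lemma K_sym: "K x \<bullet> y = x \<bullet> K y" and C_sym: "C x \<bullet> y = x \<bullet> C y" and G_sym: "G x \<bullet> y = x \<bullet> G y"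
  and K_nonneg: "0 \<le> K x \<bullet> x" and C_nonneg: "0 \<le> C x \<bullet> x" and G_nonneg: "0 \<le> G x \<bullet> x"
  using K C G self_adjoint_ops_iff unfolding nonneg_ops_def by blast+

text \<open>
  The scalar weight \<open>\<theta>\<close> on the quadratic term covers the original equation (\<open>\<theta> = 1\<close>) and the truncated one,
  in which \<open>\<theta>\<close> depends on the solution.
\<close>
definition solves :: "(real \<Rightarrow> real) \<Rightarrow> (real \<Rightarrow> 'a \<Rightarrow>\<^sub>L 'a) \<Rightarrow> bool" where
  "solves \<theta> F \<longleftrightarrow> (\<forall>t\<in>{0..T}. F t \<in> self_adjoint_ops) \<and> F T = G \<and>
     (\<forall>t\<in>{0..T}. \<forall>x. ((\<lambda>s. F s x) has_vector_derivative
        (\<theta> t *\<^sub>R F t (K (F t x)) - adj (L t) (F t x) - F t (L t x) - C x)) (at t within {0..T}))"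

definition propagator_bound :: "real \<Rightarrow> bool" where
  "propagator_bound m \<longleftrightarrow> (\<forall>t\<in>{0..T}. \<forall>y.
     (\<forall>s\<in>{t..T}. (y has_vector_derivative L s (y s)) (at s within {t..T})) \<longrightarrow>
     (\<forall>s\<in>{t..T}. norm (y s) \<le> m * norm (y t)))"

lemma solves_sym: "solves \<theta> F \<Longrightarrow> t \<in> {0..T} \<Longrightarrow> F t x \<bullet> y = x \<bullet> F t y"
  using self_adjoint_ops_iff unfolding solves_def by blast

lemma solves_cong: "(\<And>t. t \<in> {0..T} \<Longrightarrow> \<theta> t = \<theta>' t) \<Longrightarrow> solves \<theta> F \<longleftrightarrow> solves \<theta>' F"
  by (simp add: solves_def)

lemma solves_continuous:
  assumes "solves \<theta> F"
  shows "continuous_on {0..T} (\<lambda>t. F t x)"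
  unfolding continuous_on_eq_continuous_within
proof
  fix t assume "t \<in> {0..T}"
  with assms have "((\<lambda>s. F s x) has_vector_derivative
        (\<theta> t *\<^sub>R F t (K (F t x)) - adj (L t) (F t x) - F t (L t x) - C x)) (at t within {0..T})"
    unfolding solves_def by blast
  thus "continuous (at t within {0..T}) (\<lambda>t. F t x)" by (rule has_vector_derivative_continuous)
qed

lemma solves_bounded:
  assumes "solves \<theta> F"
  obtains m where "\<And>t. t \<in> {0..T} \<Longrightarrow> norm (F t) \<le> m"
  using strongly_continuous_bounded[of 0 T F] solves_continuous[OF assms] by blast

text \<open>
  By symmetry of \<open>F s\<close>, the terms with \<open>L\<close> and its adjoint cancel against the derivative of \<open>y\<close>. The feedback
  \<open>\<beta>\<close> shifts the coefficient of the quadratic term: \<open>\<beta> = \<theta> / 2\<close> removes it and \<open>\<beta> = 0\<close> keeps its sign.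
\<close>
lemma energy_derivative:
  assumes F: "solves \<theta> F" and t: "t \<in> {0..T}" and s: "s \<in> {t..T}"
    and y: "(y has_vector_derivative L s (y s) - \<beta> *\<^sub>R K (F s (y s))) (at s within {t..T})"
  shows "((\<lambda>s. F s (y s) \<bullet> y s) has_vector_derivative
    ((\<theta> s - 2 * \<beta>) * (K (F s (y s)) \<bullet> F s (y s)) - C (y s) \<bullet> y s)) (at s within {t..T})"
proof -
  obtain m where m: "\<And>t. t \<in> {0..T} \<Longrightarrow> norm (F t) \<le> m" using solves_bounded[OF F] by blast
  have s0: "s \<in> {0..T}" using s t by auto
  let ?y' = "L s (y s) - \<beta> *\<^sub>R K (F s (y s))"
  let ?F' = "\<theta> s *\<^sub>R F s (K (F s (y s))) - adj (L s) (F s (y s)) - F s (L s (y s)) - C (y s)"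
  have "((\<lambda>r. F r (y s)) has_vector_derivative ?F') (at s within {0..T})"
    using F s0 unfolding solves_def by blast
  hence F': "((\<lambda>r. F r (y s)) has_vector_derivative ?F') (at s within {t..T})"
    by (rule has_vector_derivative_within_subset) (use t in auto)
  have prod: "((\<lambda>r. F r (y r)) has_vector_derivative (?F' + F s ?y')) (at s within {t..T})"
    by (rule strong_product_rule[OF m s F' y])
       (use t in \<open>auto intro: continuous_on_subset[OF solves_continuous[OF F]]\<close>)
  have "((\<lambda>r. F r (y r) \<bullet> y r) has_vector_derivative (F s (y s) \<bullet> ?y' + (?F' + F s ?y') \<bullet> y s)) (at s within {t..T})"
    by (rule bounded_bilinear.has_vector_derivative[OF bounded_bilinear_inner prod y])
  moreover have "F s (y s) \<bullet> ?y' + (?F' + F s ?y') \<bullet> y s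
    = (\<theta> s - 2 * \<beta>) * (K (F s (y s)) \<bullet> F s (y s)) - C (y s) \<bullet> y s"
  proof -
    have "F s (L s (y s)) \<bullet> y s = F s (y s) \<bullet> L s (y s)" "F s (K (F s (y s))) \<bullet> y s = K (F s (y s)) \<bullet> F s (y s)"
      using solves_sym[OF F s0] by (metis inner_commute)+
    moreover have "adj (L s) (F s (y s)) \<bullet> y s = F s (y s) \<bullet> L s (y s)" by (metis adj_apply inner_commute)
    moreover have "F s (y s) \<bullet> K (F s (y s)) = K (F s (y s)) \<bullet> F s (y s)" by (rule inner_commute)
    ultimately show ?thesis
      by (simp add: inner_simps blinfun.bilinear_simps algebra_simps)
  qed
  ultimately show ?thesis by simp
qed

text \<open>
  With the feedback \<open>\<beta> = \<theta> / 2\<close> the energy has derivative \<open>- \<langle>C y, y\<rangle> \<le> 0\<close> and the terminal value \<open>\<langle>G y(T), y(T)\<rangle> \<ge> 0\<close>.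
\<close>
lemma solution_nonneg:
  assumes F: "solves \<theta> F" and \<theta>: "continuous_on {0..T} \<theta>" and t: "t \<in> {0..T}"
  shows "0 \<le> F t x \<bullet> x"
proof -
  define M where "M s = L s - (\<theta> s / 2) *\<^sub>R (K o\<^sub>L F s)" for s
  have sub: "{t..T} \<subseteq> {0..T}" using t by auto
  have "continuous_on {t..T} (\<lambda>s. L s x - (\<theta> s / 2) *\<^sub>R K (F s x))" for x
    by (intro continuous_on_diff continuous_on_scaleR continuous_on_divide continuous_on_const
        bounded_linear.continuous_on[OF blinfun.bounded_linear_right] continuous_on_subset[OF L sub]
        continuous_on_subset[OF \<theta> sub] continuous_on_subset[OF solves_continuous[OF F] sub]) simp
  hence "continuous_on {t..T} (\<lambda>s. M s x)" for x
    by (simp add: M_def blinfun.bilinear_simps)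
  then obtain y where y: "y t = x" "\<And>s. s \<in> {t..T} \<Longrightarrow> (y has_vector_derivative M s (y s)) (at s within {t..T})"
    using linear_evolution_exists[of t T M x] t by auto
  have "((\<lambda>s. F s (y s) \<bullet> y s) has_vector_derivative
      ((\<theta> s - 2 * (\<theta> s / 2)) * (K (F s (y s)) \<bullet> F s (y s)) - C (y s) \<bullet> y s)) (at s within {t..T})"
    if "s \<in> {t..T}" for s
    using y(2)[OF that] by (intro energy_derivative[OF F t that]) (simp add: M_def blinfun.bilinear_simps)
  hence "F T (y T) \<bullet> y T - F t (y t) \<bullet> y t \<le> (\<lambda>_. 0) T - (\<lambda>_. 0::real) t"
    using t C_nonneg
    by (intro vector_derivative_mono[where f' = "\<lambda>s. - (C (y s) \<bullet> y s)" and g' = "\<lambda>_. 0"]) auto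
  moreover have "F T = G" using F by (simp add: solves_def)
  ultimately show ?thesis using G_nonneg[of "y T"] y(1) by simp
qed

text \<open>
  Without feedback the energy has derivative at least \<open>- \<langle>C y, y\<rangle>\<close>, since \<open>\<theta> \<langle>K F y, F y\<rangle> \<ge> 0\<close>. The bound thus depends on the
  linear part only through the growth of its trajectories, and not on \<open>K\<close> or \<open>\<theta>\<close>.
\<close>
lemma solution_bound:
  assumes F: "solves \<theta> F" and \<theta>: "continuous_on {0..T} \<theta>" "\<And>s. s \<in> {0..T} \<Longrightarrow> 0 \<le> \<theta> s"
    and m: "propagator_bound m" and t: "t \<in> {0..T}"
  shows "norm (F t) \<le> (norm G + T * norm C) * m\<^sup>2"
proof (rule norm_symmetric_le)
  show "F t x \<bullet> y = x \<bullet> F t y" for x y using solves_sym[OF F t] .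
  show "0 \<le> (norm G + T * norm C) * m\<^sup>2" using T by simp
  fix x
  have "continuous_on {t..T} (\<lambda>s. L s x)" for x by (rule continuous_on_subset[OF L]) (use t in auto)
  then obtain y where y: "y t = x" "\<And>s. s \<in> {t..T} \<Longrightarrow> (y has_vector_derivative L s (y s)) (at s within {t..T})"
    using linear_evolution_exists[of t T L x] t by auto
  have ny: "norm (y s) \<le> m * norm x" if "s \<in> {t..T}" for s
    using m t y that unfolding propagator_bound_def by blast
  have q: "X (y s) \<bullet> y s \<le> norm X * (m\<^sup>2 * (norm x)\<^sup>2)" if "s \<in> {t..T}" for s and X :: "'a \<Rightarrow>\<^sub>L 'a"
  proof -
    have "X (y s) \<bullet> y s \<le> norm (X (y s)) * norm (y s)" by (rule norm_cauchy_schwarz)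
    also have "\<dots> \<le> norm X * norm (y s) * norm (y s)" by (intro mult_right_mono norm_blinfun) auto
    also have "\<dots> = norm X * (norm (y s))\<^sup>2" by (simp add: power2_eq_square)
    also have "\<dots> \<le> norm X * (m * norm x)\<^sup>2" using ny[OF that] by (intro mult_left_mono power_mono) auto
    finally show ?thesis by (simp add: power_mult_distrib)
  qed
  define c where "c = norm C * (m\<^sup>2 * (norm x)\<^sup>2)"
  have c: "0 \<le> c" by (simp add: c_def)
  have d: "((\<lambda>s. F s (y s) \<bullet> y s) has_vector_derivative
      (\<theta> s * (K (F s (y s)) \<bullet> F s (y s)) - C (y s) \<bullet> y s)) (at s within {t..T})"
    if "s \<in> {t..T}" for s
    using energy_derivative[OF F t that, of y 0] y(2)[OF that] by simp
  have "(\<lambda>s. - c * s) T - (\<lambda>s. - c * s) t \<le> F T (y T) \<bullet> y T - F t (y t) \<bullet> y t"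
  proof (rule vector_derivative_mono[OF _ _ d])
    fix s assume s: "s \<in> {t..T}"
    show "((\<lambda>s. - c * s) has_vector_derivative - c) (at s within {t..T})"
      unfolding has_real_derivative_iff_has_vector_derivative[symmetric]
      by (auto intro!: derivative_eq_intros)
    have "0 \<le> \<theta> s * (K (F s (y s)) \<bullet> F s (y s))" using \<theta>(2)[of s] s t K_nonneg by auto
    thus "- c \<le> \<theta> s * (K (F s (y s)) \<bullet> F s (y s)) - C (y s) \<bullet> y s"
      using q[OF s, of C] by (simp add: c_def)
  qed (use t in auto)
  moreover have "F T = G" using F by (simp add: solves_def)
  ultimately have "F t x \<bullet> x \<le> norm G * (m\<^sup>2 * (norm x)\<^sup>2) + c * (T - t)"
    using q[of T G] t y(1) by (simp add: algebra_simps)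
  also have "c * (T - t) \<le> c * T" using c t by (intro mult_left_mono) auto
  finally have "F t x \<bullet> x \<le> (norm G + T * norm C) * m\<^sup>2 * (norm x)\<^sup>2" by (simp add: c_def algebra_simps)
  thus "\<bar>F t x \<bullet> x\<bar> \<le> (norm G + T * norm C) * m\<^sup>2 * (norm x)\<^sup>2"
    using solution_nonneg[OF F \<theta>(1) t] by simp
qed

text \<open>
  Truncation makes the right-hand side globally Lipschitz, and the result of truncating both factors is
  \<open>\<theta> F K F\<close> with \<open>\<theta> = (\<rho> / max \<rho> \<parallel>F\<parallel>)\<^sup>2\<close>. Norm continuity of the solution is recorded because it makes \<open>\<theta>\<close> continuous.
\<close>
lemma truncated_solution_exists:
  assumes \<rho>: "0 < \<rho>"
  shows "\<exists>F. continuous_on {0..T} F \<and> solves (\<lambda>t. (\<rho> / max \<rho> (norm (F t)))\<^sup>2) F"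
proof -
  define f where "f r X = (adj (L (T - r)) o\<^sub>L X) + (X o\<^sub>L L (T - r)) + C
    - (truncate \<rho> X o\<^sub>L K o\<^sub>L truncate \<rho> X)" for r X
  have rev: "continuous_on {0..T} (\<lambda>r. T - r)" "(\<lambda>r. T - r) ` {0..T} = {0..T}"
    by (intro continuous_intros) simp
  have Lr: "continuous_on {0..T} (\<lambda>r. L (T - r) x)" and Lar: "continuous_on {0..T} (\<lambda>r. adj (L (T - r)) x)" for x
    using continuous_on_compose[OF rev(1), of "\<lambda>t. L t x"] continuous_on_compose[OF rev(1), of "\<lambda>t. adj (L t) x"]
      L L_adj rev(2) by (auto simp: o_def)
  obtain l where l: "l \<ge> 0" "\<And>r. r \<in> {0..T} \<Longrightarrow> norm (L (T - r)) \<le> l"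
    using strongly_continuous_bounded[of 0 T "\<lambda>r. L (T - r)"] Lr by blast
  obtain la where la: "la \<ge> 0" "\<And>r. r \<in> {0..T} \<Longrightarrow> norm (adj (L (T - r))) \<le> la"
    using strongly_continuous_bounded[of 0 T "\<lambda>r. adj (L (T - r))"] Lar by blast
  have "\<exists>F. continuous_on {0..T} F \<and> F 0 = G \<and> (\<forall>s\<in>{0..T}. F s \<in> self_adjoint_ops) \<and>
    (\<forall>s\<in>{0..T}. \<forall>x. ((\<lambda>s. F s x) has_vector_derivative f s (F s) x) (at s within {0..T}))"
  proof (rule strong_operator_ode[where c = "la + l + 4 * \<rho> * norm K"])
    show "0 \<le> la + l + 4 * \<rho> * norm K" using l la \<rho> by simp
    show "G \<in> self_adjoint_ops" using G by (simp add: nonneg_ops_def)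
  next
    fix F :: "real \<Rightarrow> 'a \<Rightarrow>\<^sub>L 'a" and x assume F: "continuous_on {0..T} F"
    have "continuous_on {0..T} (\<lambda>r. adj (L (T - r)) (F r x))"
      by (rule strong_continuous_on[OF la(2) Lar]) (auto intro!: continuous_intros F)
    moreover have "continuous_on {0..T} (\<lambda>r. F r (L (T - r) x))" by (rule blinfun.continuous_on[OF F Lr])
    moreover have tr: "continuous_on {0..T} (\<lambda>r. truncate \<rho> (F r))" unfolding truncate_def
      using \<rho> by (intro continuous_intros F) (auto simp: max_def)
    have "continuous_on {0..T} (\<lambda>r. truncate \<rho> (F r) (K (truncate \<rho> (F r) x)))"
      by (rule blinfun.continuous_on[OF tr bounded_linear.continuous_on[OF blinfun.bounded_linear_right
            blinfun.continuous_on[OF tr continuous_on_const]]])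
    ultimately have "continuous_on {0..T} (\<lambda>r. adj (L (T - r)) (F r x) + F r (L (T - r) x) + C x
        - truncate \<rho> (F r) (K (truncate \<rho> (F r) x)))"
      by (intro continuous_on_add continuous_on_diff continuous_on_const)
    thus "continuous_on {0..T} (\<lambda>r. f r (F r) x)"
      by (simp add: f_def blinfun.add_left blinfun.diff_left)
  next
    fix r and X Y :: "'a \<Rightarrow>\<^sub>L 'a" assume r: "r \<in> {0..T}"
    let ?X = "truncate \<rho> X" and ?Y = "truncate \<rho> Y"
    have comp: "norm (V o\<^sub>L W) \<le> v * w" if "norm V \<le> v" "norm W \<le> w" for V W :: "'a \<Rightarrow>\<^sub>L 'a" and v w
      using norm_blinfun_compose[of V W] mult_mono[OF that] that norm_ge_zero order_trans by (meson order_trans norm_ge_zero)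
    have tri: "norm (p + q - (u + v)) \<le> (a + b) + (c + d)"
      if "norm p \<le> a" "norm q \<le> b" "norm u \<le> c" "norm v \<le> d" for p q u v :: "'a \<Rightarrow>\<^sub>L 'a" and a b c d
      using that norm_triangle_ineq4[of "p + q" "u + v"] norm_triangle_ineq[of p q] norm_triangle_ineq[of u v]
      by linarith
    \<comment> \<open>Telescoping the quadratic term leaves one truncated factor of norm at most \<open>\<rho>\<close> in each summand.\<close>
    have "f r X - f r Y = (adj (L (T - r)) o\<^sub>L (X - Y)) + ((X - Y) o\<^sub>L L (T - r))
        - (((?X - ?Y) o\<^sub>L K o\<^sub>L ?X) + (?Y o\<^sub>L K o\<^sub>L (?X - ?Y)))"
      unfolding f_def by (rule blinfun_eqI) (simp add: blinfun.bilinear_simps)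
    moreover have "norm (adj (L (T - r)) o\<^sub>L (X - Y)) \<le> la * norm (X - Y)"
      and "norm ((X - Y) o\<^sub>L L (T - r)) \<le> norm (X - Y) * l"
      using l(2)[OF r] la(2)[OF r] by (auto intro!: comp)
    moreover have "norm ((?X - ?Y) o\<^sub>L K o\<^sub>L ?X) \<le> 2 * norm (X - Y) * norm K * \<rho>"
      and "norm (?Y o\<^sub>L K o\<^sub>L (?X - ?Y)) \<le> \<rho> * norm K * (2 * norm (X - Y))"
      by (intro comp norm_truncate truncate_lipschitz \<rho> order_refl)+
    ultimately have "norm (f r X - f r Y) \<le> (la * norm (X - Y) + norm (X - Y) * l)
       + (2 * norm (X - Y) * norm K * \<rho> + \<rho> * norm K * (2 * norm (X - Y)))"
      by (simp only: tri)
    thus "norm (f r X - f r Y) \<le> (la + l + 4 * \<rho> * norm K) * norm (X - Y)" by (simp add: algebra_simps)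
  next
    fix r and X :: "'a \<Rightarrow>\<^sub>L 'a" assume X: "X \<in> self_adjoint_ops"
    have 1: "X v \<bullet> w = v \<bullet> X w" for v w using X self_adjoint_ops_iff by blast
    hence 2: "truncate \<rho> X v \<bullet> w = v \<bullet> truncate \<rho> X w" for v w by (simp add: truncate_def blinfun.bilinear_simps)
    have 3: "adj (L r) v \<bullet> w = v \<bullet> L r w" for v w r by (metis adj_apply inner_commute)
    have 4: "v \<bullet> adj (L r) w = L r v \<bullet> w" for v w r by (rule adj_apply)
    show "f r X \<in> self_adjoint_ops" unfolding self_adjoint_ops_iff f_def
      by (simp add: blinfun.bilinear_simps inner_simps 1 2 3 4 K_sym C_sym)
  next
    fix H and M :: "'a \<Rightarrow>\<^sub>L 'a" and s
    assume H: "\<And>r. r \<in> {0..T} \<Longrightarrow> H r \<in> self_adjoint_ops" and s: "s \<in> {0..T}"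
      and i: "\<And>x. ((\<lambda>r. blinfun_apply (H r) x) has_integral (blinfun_apply M x - G x)) {0..s}"
    have "(M x - G x) \<bullet> y = x \<bullet> (M y - G y)" for x y
    proof (rule has_integral_unique)
      show "((\<lambda>r. H r x \<bullet> y) has_integral ((M x - G x) \<bullet> y)) {0..s}"
        using has_integral_linear[OF i bounded_linear_inner_left] by (simp add: o_def)
      have "((\<lambda>r. x \<bullet> H r y) has_integral (x \<bullet> (M y - G y))) {0..s}"
        using has_integral_linear[OF i bounded_linear_inner_right] by (simp add: o_def)
      moreover have "x \<bullet> H r y = H r x \<bullet> y" if "r \<in> {0..s}" for r
        using H[of r] that s self_adjoint_ops_iff[of "H r"] by auto
      ultimately show "((\<lambda>r. H r x \<bullet> y) has_integral (x \<bullet> (M y - G y))) {0..s}"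
        by (rule has_integral_eq[rotated])
    qed
    thus "M \<in> self_adjoint_ops" unfolding self_adjoint_ops_iff using G_sym by (simp add: inner_simps)
  qed (use T closed_self_adjoint_ops in auto)
  then obtain H where H: "continuous_on {0..T} H" "H 0 = G" "\<And>s. s \<in> {0..T} \<Longrightarrow> H s \<in> self_adjoint_ops"
    "\<And>s x. s \<in> {0..T} \<Longrightarrow> ((\<lambda>s. H s x) has_vector_derivative f s (H s) x) (at s within {0..T})"
    by blast
  \<comment> \<open>The initial value problem was solved in reversed time.\<close>
  define F where "F t = H (T - t)" for t
  have "continuous_on {0..T} F" unfolding F_def
    using continuous_on_compose[OF rev(1), of H] H(1) rev(2) by (simp add: o_def)
  moreover have "solves (\<lambda>t. (\<rho> / max \<rho> (norm (F t)))\<^sup>2) F"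
    unfolding solves_def
  proof (intro conjI ballI allI)
    show "F T = G" by (simp add: F_def H)
    show "F t \<in> self_adjoint_ops" if "t \<in> {0..T}" for t using that by (simp add: F_def H)
    fix t x assume t: "t \<in> {0..T}"
    have "((\<lambda>t. T - t) has_vector_derivative -1) (at t within {0..T})"
      unfolding has_real_derivative_iff_has_vector_derivative[symmetric]
      by (auto intro!: derivative_eq_intros)
    moreover have "((\<lambda>s. H s x) has_vector_derivative f (T - t) (H (T - t)) x) (at (T - t) within (\<lambda>t. T - t) ` {0..T})"
      unfolding rev(2) by (rule H) (use t in auto)
    ultimately have "((\<lambda>s. H s x) \<circ> (\<lambda>t. T - t) has_vector_derivative (- 1) *\<^sub>R f (T - t) (H (T - t)) x) (at t within {0..T})"
      by (rule vector_diff_chain_within)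
    moreover have "(- 1) *\<^sub>R f (T - t) (H (T - t)) x = (\<rho> / max \<rho> (norm (F t)))\<^sup>2 *\<^sub>R F t (K (F t x))
        - adj (L t) (F t x) - F t (L t x) - C x"
      by (simp add: f_def F_def truncate_def blinfun.bilinear_simps power2_eq_square)
    ultimately show "((\<lambda>s. F s x) has_vector_derivative (\<rho> / max \<rho> (norm (F t)))\<^sup>2 *\<^sub>R F t (K (F t x))
        - adj (L t) (F t x) - F t (L t x) - C x) (at t within {0..T})"
      by (simp add: o_def F_def)
  qed
  ultimately show ?thesis by blast
qed

text \<open>
  The a priori bound does not depend on the truncation radius, so a radius above it is never active.
\<close>
lemma solution_exists:
  assumes m: "propagator_bound m"
  shows "\<exists>F. solves (\<lambda>_. 1) F"
proof -
  define \<rho> where "\<rho> = (norm G + T * norm C) * m\<^sup>2 + 1"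
  have \<rho>: "0 < \<rho>" using T by (simp add: \<rho>_def add_nonneg_pos)
  obtain F where F: "continuous_on {0..T} F" "solves (\<lambda>t. (\<rho> / max \<rho> (norm (F t)))\<^sup>2) F"
    using truncated_solution_exists[OF \<rho>] by blast
  have "continuous_on {0..T} (\<lambda>t. (\<rho> / max \<rho> (norm (F t)))\<^sup>2)"
    using \<rho> by (intro continuous_intros F) (auto simp: max_def)
  hence "norm (F t) \<le> \<rho>" if "t \<in> {0..T}" for t
    using solution_bound[OF F(2) _ _ m that] by (simp add: \<rho>_def)
  hence "\<rho> / max \<rho> (norm (F t)) = 1" if "t \<in> {0..T}" for t
    using that \<rho> by (simp add: max_absorb1)
  hence "solves (\<lambda>_. 1) F" using F(2) \<rho> by (subst (asm) solves_cong[where \<theta>' = "\<lambda>_. 1"]) simp_all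
  thus ?thesis by blast
qed

lemma solves_rhs_continuous:
  assumes F: "solves (\<lambda>_. c) F"
  shows "continuous_on {0..T} (\<lambda>t. c *\<^sub>R F t (K (F t x)) - adj (L t) (F t x) - F t (L t x) - C x)"
proof -
  obtain m where m: "\<And>t. t \<in> {0..T} \<Longrightarrow> norm (F t) \<le> m" using solves_bounded[OF F] by blast
  obtain l where l: "\<And>t. t \<in> {0..T} \<Longrightarrow> norm (adj (L t)) \<le> l"
    using strongly_continuous_bounded[of 0 T "\<lambda>t. adj (L t)"] L_adj by blast
  note Fc = solves_continuous[OF F]
  have "continuous_on {0..T} (\<lambda>t. F t (K (F t x)))"
    by (rule strong_continuous_on[OF m Fc bounded_linear.continuous_on[OF blinfun.bounded_linear_right Fc]])
  moreover have "continuous_on {0..T} (\<lambda>t. adj (L t) (F t x))"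
    by (rule strong_continuous_on[OF l L_adj Fc])
  moreover have "continuous_on {0..T} (\<lambda>t. F t (L t x))"
    by (rule strong_continuous_on[OF m Fc L])
  ultimately show ?thesis
    by (intro continuous_on_diff continuous_on_scaleR continuous_on_const)
qed

text \<open>
  Strict solutions are phrased with the derivative operator on \<open>[0,T]\<close> and a continuous derivative; the latter
  is automatic, since the right-hand side of the equation is strongly continuous along a solution.
\<close>
lemma strict_eta_riccati_iff_solves:
  assumes L_eq: "\<And>t. L t = A - (K o\<^sub>L P t)" and P: "\<And>t. t \<in> {0..T} \<Longrightarrow> P t \<in> self_adjoint_ops"
  shows "strict_eta_riccati T P K A (- C) G \<eta> \<longleftrightarrow> solves (\<lambda>_. 1) \<eta>"
proof -
  define rhs where "rhs t x = 1 *\<^sub>R \<eta> t (K (\<eta> t x)) - adj (L t) (\<eta> t x) - \<eta> t (L t x) - C x" for t x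
  have adjL: "adj (L t) = adj A - (P t o\<^sub>L K)" if t: "t \<in> {0..T}" for t
  proof (rule adj_eqI)
    fix x y
    have "P t v \<bullet> w = v \<bullet> P t w" for v w using P[OF t] self_adjoint_ops_iff by blast
    thus "x \<bullet> (adj A - (P t o\<^sub>L K)) y = L t x \<bullet> y"
      by (simp add: L_eq blinfun.bilinear_simps inner_simps adj_apply K_sym)
  qed
  have eq: "blinfun_apply ((((P t o\<^sub>L K) - adj A) o\<^sub>L \<eta> t) - (\<eta> t o\<^sub>L (A - (K o\<^sub>L P t))) + (- C)
      + (\<eta> t o\<^sub>L K o\<^sub>L \<eta> t)) x = rhs t x" if "t \<in> {0..T}" for t x
    unfolding rhs_def adjL[OF that] by (simp add: L_eq blinfun.bilinear_simps)
  have nb: "at t within {0..T} \<noteq> bot" if "t \<in> {0..T}" for t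
    using T that islimpt_Icc[of 0 T t] by (simp add: trivial_limit_within)
  show ?thesis
  proof
    assume \<eta>: "strict_eta_riccati T P K A (- C) G \<eta>"
    have "((\<lambda>s. \<eta> s x) has_vector_derivative rhs t x) (at t within {0..T})" if t: "t \<in> {0..T}" for t x
    proof -
      obtain f' where f': "((\<lambda>s. \<eta> s x) has_vector_derivative f' t) (at t within {0..T})"
        using \<eta> t unfolding strict_eta_riccati_def C1s_def by blast
      have "vector_derivative (\<lambda>s. \<eta> s x) (at t within {0..T}) = rhs t x"
        using \<eta> t eq[OF t] unfolding strict_eta_riccati_def by metis
      with vector_derivative_within[OF nb[OF t] f'] f' show ?thesis by simp
    qed
    thus "solves (\<lambda>_. 1) \<eta>" using \<eta> unfolding solves_def strict_eta_riccati_def C1s_def rhs_def by blast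
  next
    assume \<eta>: "solves (\<lambda>_. 1) \<eta>"
    have d: "((\<lambda>s. \<eta> s x) has_vector_derivative rhs t x) (at t within {0..T})" if "t \<in> {0..T}" for t x
      using \<eta> that unfolding solves_def rhs_def by blast
    have "continuous_on {0..T} (\<lambda>t. rhs t x)" for x
      unfolding rhs_def by (rule solves_rhs_continuous[OF \<eta>])
    hence "\<eta> \<in> C1s T self_adjoint_ops"
      using \<eta> d unfolding C1s_def solves_def by blast
    moreover have "\<eta> T = G" using \<eta> by (simp add: solves_def)
    ultimately show "strict_eta_riccati T P K A (- C) G \<eta>"
      unfolding strict_eta_riccati_def using eq vector_derivative_within[OF nb d] by simp
  qed
qed

end

section \<open>Resolvents and Yosida approximations in the rescaled norm\<close>

locale semigroup_generator =
  fixes D :: "'a::banach set" and A :: "'a \<Rightarrow> 'a" and E :: "real \<Rightarrow> 'a \<Rightarrow>\<^sub>L 'a" and M \<omega> :: real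
  assumes closed_A: "closed_densely_defined D A" and gen: "generates D A E"
    and M: "1 \<le> M" and growth: "\<And>t. 0 \<le> t \<Longrightarrow> norm (E t) \<le> M * exp (\<omega> * t)"
begin

lemma E_0: "E 0 = id_blinfun" and E_add: "0 \<le> s \<Longrightarrow> 0 \<le> t \<Longrightarrow> E (s + t) x = E s (E t x)"
  and E_continuous: "continuous_on {0..} (\<lambda>t. E t x)"
  using gen by (auto simp: generates_def C0_semigroup_def)

lemma mem_D_iff: "x \<in> D \<longleftrightarrow> (\<exists>y. ((\<lambda>h. (E h x - x) /\<^sub>R h) \<longlongrightarrow> y) (at_right 0))"
  using gen unfolding generates_def by blast

lemma generator_limit: "x \<in> D \<Longrightarrow> ((\<lambda>h. (E h x - x) /\<^sub>R h) \<longlongrightarrow> A x) (at_right 0)"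
  using gen unfolding generates_def by blast

lemma generatorI:
  assumes "((\<lambda>h. (E h x - x) /\<^sub>R h) \<longlongrightarrow> y) (at_right 0)"
  shows "x \<in> D" "A x = y"
proof -
  show "x \<in> D" using assms mem_D_iff by blast
  from tendsto_unique[OF _ generator_limit[OF this] assms] show "A x = y" by simp
qed

lemma A_diff: assumes "x \<in> D" "y \<in> D" shows "x - y \<in> D" "A (x - y) = A x - A y"
  and A_add: "x + y \<in> D" "A (x + y) = A x + A y"
proof -
  have S: "subspace ((\<lambda>x. (x, A x)) ` D)" using closed_A by (simp add: closed_densely_defined_def)
  have "(x, A x) - (y, A y) \<in> (\<lambda>x. (x, A x)) ` D" by (rule subspace_diff[OF S]) (use assms in auto)
  thus "x - y \<in> D" "A (x - y) = A x - A y" by auto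
  have "(x, A x) + (y, A y) \<in> (\<lambda>x. (x, A x)) ` D" by (rule subspace_add[OF S]) (use assms in auto)
  thus "x + y \<in> D" "A (x + y) = A x + A y" by auto
qed

lemma A_scaleR: assumes "x \<in> D" shows "c *\<^sub>R x \<in> D" "A (c *\<^sub>R x) = c *\<^sub>R A x"
proof -
  have S: "subspace ((\<lambda>x. (x, A x)) ` D)" using closed_A by (simp add: closed_densely_defined_def)
  have "c *\<^sub>R (x, A x) \<in> (\<lambda>x. (x, A x)) ` D" by (rule subspace_scale[OF S]) (use assms in auto)
  thus "c *\<^sub>R x \<in> D" "A (c *\<^sub>R x) = c *\<^sub>R A x" by auto
qed

text \<open>
  The equivalent norm in which the rescaled semigroup \<open>e\<^bsup>-\<omega> t\<^esup> E t\<close> is contractive. It turns the power estimates of the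
  Hille-Yosida theorem into an estimate for a single resolvent.
\<close>
definition tnorm :: "'a \<Rightarrow> real" where
  "tnorm x = (SUP t\<in>{0..}. exp (- \<omega> * t) * norm (E t x))"

lemma orbit_bound: "0 \<le> t \<Longrightarrow> exp (- \<omega> * t) * norm (E t x) \<le> M * norm x"
proof -
  assume t: "0 \<le> t"
  have "norm (E t x) \<le> M * exp (\<omega> * t) * norm x"
    using norm_blinfun[of "E t" x] growth[OF t] by (smt (verit) mult_right_mono norm_ge_zero)
  hence "exp (- \<omega> * t) * norm (E t x) \<le> exp (- \<omega> * t) * (M * exp (\<omega> * t) * norm x)"
    by (intro mult_left_mono) auto
  also have "\<dots> = (exp (- \<omega> * t) * exp (\<omega> * t)) * (M * norm x)" by simp
  also have "\<dots> = M * norm x" by (simp add: exp_add[symmetric])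
  finally show ?thesis .
qed

lemma orbit_le_tnorm: assumes t: "0 \<le> t" shows "norm (E t x) \<le> exp (\<omega> * t) * tnorm x"
proof -
  have "exp (- \<omega> * t) * norm (E t x) \<le> tnorm x" unfolding tnorm_def
    by (rule cSUP_upper) (use t orbit_bound in \<open>auto intro!: bdd_aboveI2\<close>)
  hence "exp (\<omega> * t) * (exp (- \<omega> * t) * norm (E t x)) \<le> exp (\<omega> * t) * tnorm x"
    by (intro mult_left_mono) auto
  thus ?thesis by (simp add: mult.assoc[symmetric] exp_add[symmetric])
qed

lemma tnorm_least:
  assumes "\<And>t. 0 \<le> t \<Longrightarrow> norm (E t x) \<le> exp (\<omega> * t) * c"
  shows "tnorm x \<le> c"
  unfolding tnorm_def
proof (rule cSUP_least)
  fix t :: real assume "t \<in> {0..}"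
  hence "exp (- \<omega> * t) * norm (E t x) \<le> exp (- \<omega> * t) * (exp (\<omega> * t) * c)"
    using assms by (intro mult_left_mono) auto
  thus "exp (- \<omega> * t) * norm (E t x) \<le> c" by (simp add: mult.assoc[symmetric] exp_add[symmetric])
qed auto

lemma norm_le_tnorm: "norm x \<le> tnorm x"
  using orbit_le_tnorm[of 0 x] by (simp add: E_0)

lemma tnorm_nonneg: "0 \<le> tnorm x"
  using norm_le_tnorm norm_ge_zero order_trans by blast

lemma tnorm_le: "tnorm x \<le> M * norm x"
  unfolding tnorm_def by (rule cSUP_least) (use orbit_bound in auto)

lemma tnorm_add: "tnorm (x + y) \<le> tnorm x + tnorm y"
proof (rule tnorm_least)
  fix t :: real assume t: "0 \<le> t"
  show "norm (E t (x + y)) \<le> exp (\<omega> * t) * (tnorm x + tnorm y)"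
    using orbit_le_tnorm[OF t, of x] orbit_le_tnorm[OF t, of y] norm_triangle_ineq[of "E t x" "E t y"]
    by (simp add: blinfun.add_right distrib_left)
qed

lemma tnorm_scaleR: "tnorm (c *\<^sub>R x) = \<bar>c\<bar> * tnorm x"
proof -
  have *: "tnorm (c *\<^sub>R x) \<le> \<bar>c\<bar> * tnorm x" for c x
  proof (rule tnorm_least)
    fix t :: real assume t: "0 \<le> t"
    show "norm (E t (c *\<^sub>R x)) \<le> exp (\<omega> * t) * (\<bar>c\<bar> * tnorm x)"
      using mult_left_mono[OF orbit_le_tnorm[OF t, of x] abs_ge_zero[of c]]
      by (simp add: blinfun.scaleR_right mult_ac)
  qed
  show ?thesis
  proof (cases "c = 0")
    case True thus ?thesis using *[of 0 x] tnorm_nonneg[of 0] by simp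
  next
    case False
    have "tnorm x \<le> \<bar>inverse c\<bar> * tnorm (c *\<^sub>R x)" using *[of "inverse c" "c *\<^sub>R x"] False by simp
    hence "\<bar>c\<bar> * tnorm x \<le> tnorm (c *\<^sub>R x)" using False by (simp add: field_simps)
    thus ?thesis using *[of c x] by simp
  qed
qed

lemma tnorm_diff: "tnorm (x - y) \<le> tnorm x + tnorm y"
  using tnorm_add[of x "- y"] tnorm_scaleR[of "-1" y] by simp

lemma tnorm_semigroup: assumes h: "0 \<le> h" shows "tnorm (E h x) \<le> exp (\<omega> * h) * tnorm x"
proof (rule tnorm_least)
  fix t :: real assume t: "0 \<le> t"
  show "norm (E t (E h x)) \<le> exp (\<omega> * t) * (exp (\<omega> * h) * tnorm x)"
    using orbit_le_tnorm[of "t + h" x] t h by (simp add: E_add distrib_left exp_add mult_ac)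
qed

lemma tnorm_continuous: "continuous_on S tnorm"
proof -
  have *: "tnorm x \<le> tnorm y + M * norm (x - y)" for x y
    using tnorm_add[of y "x - y"] tnorm_le[of "x - y"] by simp
  have "dist (tnorm x) (tnorm y) \<le> M * dist x y" for x y
    using *[of x y] *[of y x] by (simp add: dist_norm norm_minus_commute)
  hence "M-lipschitz_on S tnorm" by (rule lipschitz_onI) (use M in auto)
  thus ?thesis by (rule lipschitz_on_continuous_on)
qed

text \<open>
  From \<open>(1 + l h) x = E h x + h (l x - A x) + o(h)\<close> and the bound \<open>e\<^bsup>\<omega> h\<^esup>\<close> for \<open>E h\<close> in \<^const>\<open>tnorm\<close>; divide by \<open>h\<close>
  and let \<open>h\<close> tend to 0.
\<close>
lemma dissipative:
  assumes x: "x \<in> D"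
  shows "(l - \<omega>) * tnorm x \<le> tnorm (l *\<^sub>R x - A x)"
proof -
  define y where "y = l *\<^sub>R x - A x"
  define r where "r h = (E h x - x) /\<^sub>R h - A x" for h
  have r: "(r \<longlongrightarrow> 0) (at_right 0)" unfolding r_def using generator_limit[OF x] by (simp add: LIM_zero_iff)
  have le: "(l - (exp (\<omega> * h) - 1) / h) * tnorm x \<le> tnorm y + M * norm (r h)" if h: "h > 0" for h
  proof -
    have "(1 + l * h) *\<^sub>R x = E h x + h *\<^sub>R y - h *\<^sub>R r h"
      using h by (simp add: y_def r_def algebra_simps)
    hence "\<bar>1 + l * h\<bar> * tnorm x = tnorm (E h x + h *\<^sub>R y - h *\<^sub>R r h)"
      by (simp flip: tnorm_scaleR)
    also have "\<dots> \<le> tnorm (E h x) + tnorm (h *\<^sub>R y) + tnorm (h *\<^sub>R r h)"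
      using tnorm_diff[of "E h x + h *\<^sub>R y" "h *\<^sub>R r h"] tnorm_add[of "E h x" "h *\<^sub>R y"] by simp
    also have "\<dots> \<le> exp (\<omega> * h) * tnorm x + h * tnorm y + h * (M * norm (r h))"
      using tnorm_semigroup[of h x] tnorm_le[of "r h"] h by (simp add: tnorm_scaleR add_mono)
    finally have "(1 + l * h) * tnorm x \<le> exp (\<omega> * h) * tnorm x + h * tnorm y + h * (M * norm (r h))"
      using mult_right_mono[OF abs_ge_self tnorm_nonneg[of x], of "1 + l * h"] by simp
    thus ?thesis using h by (simp add: field_simps)
  qed
  have "((\<lambda>h. exp (\<omega> * h)) has_real_derivative \<omega>) (at_right 0)"
    by (auto intro!: derivative_eq_intros)
  hence "((\<lambda>h. (exp (\<omega> * h) - 1) / h) \<longlongrightarrow> \<omega>) (at_right 0)"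
    by (simp add: has_field_derivative_iff)
  hence "((\<lambda>h. (l - (exp (\<omega> * h) - 1) / h) * tnorm x) \<longlongrightarrow> (l - \<omega>) * tnorm x) (at_right 0)"
    by (intro tendsto_intros)
  moreover have "((\<lambda>h. tnorm y + M * norm (r h)) \<longlongrightarrow> tnorm y + M * norm (0::'a)) (at_right 0)"
    by (intro tendsto_intros r)
  moreover have "\<forall>\<^sub>F h in at_right 0. (l - (exp (\<omega> * h) - 1) / h) * tnorm x \<le> tnorm y + M * norm (r h)"
    using le by (auto simp: eventually_at_right_field intro: exI[of _ 1])
  ultimately have "(l - \<omega>) * tnorm x \<le> tnorm y + M * norm (0::'a)"
    by (intro tendsto_le[of "at_right (0::real)"]) auto
  thus ?thesis by (simp add: y_def)
qed

text \<open>
  The Laplace transform over \<open>[0,a]\<close> solves the resolvent equation up to the boundary term at \<open>a\<close>. Applying \<open>E h\<close> shifts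
  the interval of integration, so the difference quotient is that of an integral in its limits.
\<close>
lemma truncated_laplace:
  fixes a l :: real and y :: 'a
  assumes a: "0 \<le> a"
  defines "z \<equiv> integral {0..a} (\<lambda>u. exp (- l * u) *\<^sub>R E u y)"
  shows "z \<in> D" "l *\<^sub>R z - A z = y - exp (- l * a) *\<^sub>R E a y"
proof -
  define g where "g u = exp (- l * u) *\<^sub>R E u y" for u
  have zg: "z = integral {0..a} g" unfolding z_def g_def ..
  define Z where "Z u = integral {0..u} g" for u
  have g: "continuous_on {0..b} g" for b unfolding g_def
    by (intro continuous_intros continuous_on_subset[OF E_continuous]) auto
  have dZ: "(Z has_vector_derivative g u) (at u within {0..b})" if "u \<in> {0..b}" for u b
    unfolding Z_def by (rule integral_has_vector_derivative[OF g that])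
  define \<phi> where "\<phi> h = exp (l * h) *\<^sub>R (Z (a + h) - Z h)" for h
  have Eh: "E h z = \<phi> h" if h: "0 \<le> h" for h
  proof -
    have gi: "g integrable_on {0..b}" for b by (intro integrable_continuous_real g)
    have "E h z = integral {0..a} (\<lambda>u. E h (g u))"
      using integral_linear[OF gi blinfun.bounded_linear_right, of a "E h"] by (simp add: zg o_def)
    also have "\<dots> = integral {0..a} (\<lambda>u. exp (l * h) *\<^sub>R g (h + u))"
    proof (rule integral_cong)
      fix u assume "u \<in> {0..a}"
      hence "E h (g u) = exp (- l * u) *\<^sub>R E (u + h) y"
        using h E_add[of h u y] by (simp add: g_def blinfun.scaleR_right add.commute)
      also have "exp (- l * u) = exp (l * h) * exp (- l * (u + h))"
        by (simp add: exp_add[symmetric] algebra_simps)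
      finally show "E h (g u) = exp (l * h) *\<^sub>R g (h + u)" by (simp add: g_def add.commute)
    qed
    also have "\<dots> = exp (l * h) *\<^sub>R integral {0..a} (g \<circ> (+) h)" by (simp add: o_def)
    also have "integral {0..a} (g \<circ> (+) h) = integral {0 + h..a + h} g" by (rule integral_shift_Icc_real)
    also have "\<dots> = Z (a + h) - Z h"
      using Henstock_Kurzweil_Integration.integral_combine[of 0 h "a + h" g] gi a h by (simp add: Z_def algebra_simps)
    finally show ?thesis by (simp add: \<phi>_def)
  qed
  have z: "z = \<phi> 0" by (simp add: \<phi>_def Z_def zg)
  have dZa: "((\<lambda>h. Z (a + h)) has_vector_derivative g a) (at 0 within {0..1})"
  proof -
    have "((\<lambda>h. a + h) has_vector_derivative 1) (at 0 within {0..1})"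
      by (auto intro!: derivative_eq_intros)
    moreover have "(Z has_vector_derivative g a) (at (a + 0) within (\<lambda>h. a + h) ` {0..1})"
      unfolding add_0_right
      by (rule has_vector_derivative_within_subset[OF dZ[of a "a + 1"]]) (use a in auto)
    ultimately have "(Z \<circ> (\<lambda>h. a + h) has_vector_derivative 1 *\<^sub>R g a) (at 0 within {0..1})"
      by (rule vector_diff_chain_within)
    thus ?thesis by (simp add: o_def)
  qed
  have dexp: "((\<lambda>h. exp (l * h)) has_real_derivative l) (at 0 within {0..1})"
    by (auto intro!: derivative_eq_intros)
  have "(\<phi> has_vector_derivative exp (l * 0) *\<^sub>R (g a - g 0) + l *\<^sub>R (Z (a + 0) - Z 0)) (at 0 within {0..1})"
    unfolding \<phi>_def
    by (intro has_vector_derivative_scaleR dexp has_vector_derivative_diff dZa dZ) auto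
  hence "((\<lambda>h. (\<phi> h - \<phi> 0) /\<^sub>R h) \<longlongrightarrow> g a - g 0 + l *\<^sub>R z) (at_right 0)"
    unfolding has_vector_derivative_iff_quotient
    by (simp add: at_within_Icc_at_right Z_def zg)
  moreover have "\<forall>\<^sub>F h in at_right 0. (\<phi> h - \<phi> 0) /\<^sub>R h = (E h z - z) /\<^sub>R h"
    using Eh z by (auto simp: eventually_at_right_field intro!: exI[of _ 1])
  ultimately have "((\<lambda>h. (E h z - z) /\<^sub>R h) \<longlongrightarrow> g a - g 0 + l *\<^sub>R z) (at_right 0)"
    by (rule Lim_transform_eventually)
  from generatorI[OF this] show "z \<in> D" "l *\<^sub>R z - A z = y - exp (- l * a) *\<^sub>R E a y"
    by (auto simp: g_def E_0)
qed

text \<open>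
  Truncated Laplace transforms are approximate solutions with right-hand sides converging to \<open>y\<close>. By dissipativity
  they form a Cauchy sequence, and the limit is a solution because \<open>A\<close> is closed.
\<close>
lemma resolvent_surj:
  assumes l: "\<omega> < l"
  shows "\<exists>x\<in>D. l *\<^sub>R x - A x = y"
proof -
  define z where "z n = integral {0..real n} (\<lambda>u. exp (- l * u) *\<^sub>R E u y)" for n
  define w where "w n = y - exp (- l * real n) *\<^sub>R E (real n) y" for n
  have z: "z n \<in> D" "l *\<^sub>R z n - A (z n) = w n" for n
    using truncated_laplace[of "real n" l y] by (auto simp: z_def w_def)
  have w: "w \<longlonglongrightarrow> y"
  proof -
    have "norm (exp (- l * real n) *\<^sub>R E (real n) y) \<le> M * norm y * exp (- (l - \<omega>)) ^ n" for n
    proof -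
      have "exp (- l * real n) = exp ((\<omega> - l) * real n) * exp (- \<omega> * real n)"
        by (simp add: exp_add[symmetric] left_diff_distrib)
      hence "norm (exp (- l * real n) *\<^sub>R E (real n) y) = exp ((\<omega> - l) * real n) * (exp (- \<omega> * real n) * norm (E (real n) y))"
        by simp
      also have "\<dots> \<le> exp ((\<omega> - l) * real n) * (M * norm y)" by (intro mult_left_mono orbit_bound) auto
      also have "exp ((\<omega> - l) * real n) = exp (- (l - \<omega>)) ^ n"
        unfolding exp_of_nat2_mult[symmetric] by simp
      finally show ?thesis by (simp only: mult_ac)
    qed
    moreover have "(\<lambda>n. M * norm y * exp (- (l - \<omega>)) ^ n) \<longlonglongrightarrow> 0"
      using l by (intro tendsto_mult_right_zero LIMSEQ_power_zero) auto
    ultimately have "(\<lambda>n. exp (- l * real n) *\<^sub>R E (real n) y) \<longlonglongrightarrow> 0"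
      by (intro Lim_null_comparison[of "\<lambda>n. exp (- l * real n) *\<^sub>R E (real n) y"]) auto
    from tendsto_diff[OF tendsto_const this] show ?thesis unfolding w_def by simp
  qed
  have est: "norm (z i - z j) \<le> M / (l - \<omega>) * norm (w i - w j)" for i j
  proof -
    have "l *\<^sub>R (z i - z j) - A (z i - z j) = w i - w j"
      unfolding A_diff(2)[OF z(1) z(1)] z(2)[symmetric] by (simp add: scaleR_diff_right)
    hence "(l - \<omega>) * tnorm (z i - z j) \<le> M * norm (w i - w j)"
      using dissipative[OF A_diff(1)[OF z(1)[of i] z(1)[of j]], of l] tnorm_le[of "w i - w j"] by simp
    moreover have "(l - \<omega>) * norm (z i - z j) \<le> (l - \<omega>) * tnorm (z i - z j)"
      using l norm_le_tnorm by (intro mult_left_mono) auto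
    ultimately show ?thesis using l by (simp add: field_simps)
  qed
  have "Cauchy z"
  proof (rule CauchyI)
    fix e :: real assume e: "0 < e"
    define q where "q = M / (l - \<omega>)"
    have q: "q > 0" using l M by (simp add: q_def)
    obtain n0 where n0: "\<And>i j. i \<ge> n0 \<Longrightarrow> j \<ge> n0 \<Longrightarrow> norm (w i - w j) < e / q"
      using CauchyD[OF LIMSEQ_imp_Cauchy[OF w], of "e / q"] divide_pos_pos[OF e q] by blast
    have "norm (z i - z j) < e" if "i \<ge> n0" "j \<ge> n0" for i j
    proof -
      have "norm (z i - z j) \<le> q * norm (w i - w j)" using est by (simp only: q_def)
      also have "\<dots> < q * (e / q)" by (rule mult_strict_left_mono[OF n0[OF that] q])
      also have "\<dots> = e" using q by simp
      finally show ?thesis .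
    qed
    thus "\<exists>M. \<forall>m\<ge>M. \<forall>n\<ge>M. norm (z m - z n) < e" by blast
  qed
  then obtain x where x: "z \<longlonglongrightarrow> x" using Cauchy_convergent_iff convergent_def by blast
  have "(\<lambda>n. l *\<^sub>R z n - w n) \<longlonglongrightarrow> l *\<^sub>R x - y" by (intro tendsto_intros x w)
  moreover have "l *\<^sub>R z n - w n = A (z n)" for n using z(2)[of n] by (simp add: algebra_simps)
  ultimately have lim: "(\<lambda>n. (z n, A (z n))) \<longlonglongrightarrow> (x, l *\<^sub>R x - y)" using x by (intro tendsto_Pair) auto
  have cl: "closed ((\<lambda>x. (x, A x)) ` D)" using closed_A by (simp add: closed_densely_defined_def)
  have gr: "(z n, A (z n)) \<in> (\<lambda>x. (x, A x)) ` D" for n using z(1) by blast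
  have "(x, l *\<^sub>R x - y) \<in> (\<lambda>x. (x, A x)) ` D" by (rule closed_sequentially[OF cl gr lim])
  hence "x \<in> D" "A x = l *\<^sub>R x - y" by auto
  thus ?thesis by (intro bexI[of _ x]) auto
qed

text \<open>
  Injectivity, boundedness and the estimate are all read off from \<open>dissipative\<close>.
\<close>
lemma tnorm_resolvent:
  assumes l: "\<omega> < l"
  shows "tnorm (resolvent D A l y) \<le> tnorm y / (l - \<omega>)"
proof -
  have inj: "inj_on (\<lambda>x. l *\<^sub>R x - A x) D"
  proof (rule inj_onI)
    fix u v assume uv: "u \<in> D" "v \<in> D" "l *\<^sub>R u - A u = l *\<^sub>R v - A v"
    hence "l *\<^sub>R (u - v) - A (u - v) = 0" using uv(3) unfolding A_diff(2)[OF uv(1,2)] scaleR_diff_right by (simp add: algebra_simps)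
    with dissipative[OF A_diff(1)[OF uv(1,2)], of l] have "(l - \<omega>) * tnorm (u - v) \<le> 0"
      using tnorm_scaleR[of 0 0] by simp
    hence "tnorm (u - v) \<le> 0" using l by (simp add: mult_le_0_iff)
    hence "norm (u - v) \<le> 0" using norm_le_tnorm[of "u - v"] by linarith
    thus "u = v" by simp
  qed
  let ?R = "the_inv_into D (\<lambda>x. l *\<^sub>R x - A x)"
  have surj: "(\<lambda>x. l *\<^sub>R x - A x) ` D = UNIV" 
  proof -
    have "y \<in> (\<lambda>x. l *\<^sub>R x - A x) ` D" for y
    proof -
      obtain x where "x \<in> D" "l *\<^sub>R x - A x = y" using resolvent_surj[OF l] by blast
      thus ?thesis by (intro image_eqI[of _ _ x]) auto
    qed
    thus ?thesis by (intro UNIV_eq_I[symmetric])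
  qed
  have R: "?R y \<in> D" "l *\<^sub>R ?R y - A (?R y) = y" for y
    using the_inv_into_into[OF inj, of y D] f_the_inv_into_f[OF inj, of y] surj by auto
  have RI: "?R y = x" if "x \<in> D" "l *\<^sub>R x - A x = y" for x y
    using the_inv_into_f_eq[OF inj that(2,1)] .
  have bd: "tnorm (?R y) \<le> tnorm y / (l - \<omega>)" for y
    using dissipative[OF R(1)[of y], of l] R(2)[of y] l by (simp add: field_simps)
  have "bounded_linear ?R"
  proof (rule bounded_linear_intro[where K = "M / (l - \<omega>)"])
    show "?R (u + v) = ?R u + ?R v" for u v
    proof (rule RI[OF A_add(1)[OF R(1) R(1)]])
      have "l *\<^sub>R (?R u + ?R v) - A (?R u + ?R v) = (l *\<^sub>R ?R u - A (?R u)) + (l *\<^sub>R ?R v - A (?R v))"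
        unfolding A_add(2)[OF R(1) R(1)] by (simp add: scaleR_add_right)
      thus "l *\<^sub>R (?R u + ?R v) - A (?R u + ?R v) = u + v" unfolding R(2) .
    qed
    show "?R (c *\<^sub>R u) = c *\<^sub>R ?R u" for c u
    proof (rule RI[OF A_scaleR(1)[OF R(1)]])
      have "l *\<^sub>R c *\<^sub>R ?R u - A (c *\<^sub>R ?R u) = c *\<^sub>R (l *\<^sub>R ?R u - A (?R u))"
        unfolding A_scaleR(2)[OF R(1)] by (simp add: scaleR_diff_right)
      thus "l *\<^sub>R c *\<^sub>R ?R u - A (c *\<^sub>R ?R u) = c *\<^sub>R u" unfolding R(2) .
    qed
    show "norm (?R u) \<le> norm u * (M / (l - \<omega>))" for u
    proof -
      have "norm (?R u) \<le> tnorm u / (l - \<omega>)" using bd[of u] norm_le_tnorm order_trans by blast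
      also have "\<dots> \<le> M * norm u / (l - \<omega>)" using l tnorm_le by (intro divide_right_mono) auto
      finally show ?thesis by (simp add: mult_ac)
    qed
  qed
  thus ?thesis using bd by (simp add: resolvent_def bounded_linear_Blinfun_apply)
qed

text \<open>
  The factor \<open>z s = e\<^bsup>n (s - t)\<^esup> y s\<close> removes the term \<open>- n\<close> of the Yosida approximation and leaves \<open>n\<^sup>2 R(n,A)\<close>,
  whose norm is at most \<open>n\<^sup>2 / (n - \<omega>)\<close>. Gronwall's lemma applies to \<open>tnorm (z s)\<close>; the integral inequality is
  proved for every \<open>E \<tau> (z s)\<close> and then passes to the supremum over \<open>\<tau>\<close>.
\<close>
lemma yosida_propagator_bound:
  assumes n: "0 < n" "\<omega> < real n"
    and W: "\<And>s. s \<in> {t..T} \<Longrightarrow> norm (W s) \<le> w" "0 \<le> w"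
    and y: "\<And>s. s \<in> {t..T} \<Longrightarrow> (y has_vector_derivative yosida D A n (y s) + blinfun_apply (W s) (y s)) (at s within {t..T})"
    and s: "s \<in> {t..T}"
  shows "norm (y s) \<le> M * exp ((\<omega> + \<omega>\<^sup>2 / (real n - \<omega>) + M * w) * (s - t)) * norm (y t)"
proof -
  define N where "N = real n"
  define R where "R = resolvent D A N"
  define c where "c = N\<^sup>2 / (N - \<omega>) + M * w"
  define z where "z s = exp (N * (s - t)) *\<^sub>R y s" for s
  have N: "0 < N" "\<omega> < N" using n by (auto simp: N_def)
  have c: "0 \<le> c" using N W(2) M by (simp add: c_def)
  have dz: "(z has_vector_derivative N\<^sup>2 *\<^sub>R R (z s) + W s (z s)) (at s within {t..T})" if s: "s \<in> {t..T}" for s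
  proof -
    have "((\<lambda>s. exp (N * (s - t))) has_real_derivative exp (N * (s - t)) * N) (at s within {t..T})"
      by (auto intro!: derivative_eq_intros)
    from has_vector_derivative_scaleR[OF this y[OF s]] show ?thesis unfolding z_def
      by (simp add: yosida_def R_def N_def blinfun.bilinear_simps algebra_simps)
  qed
  have zc: "continuous_on {t..T} z"
    unfolding continuous_on_eq_continuous_within using dz has_vector_derivative_continuous by blast
  have tz: "continuous_on {t..s} (\<lambda>r. tnorm (z r))" if "s \<in> {t..T}" for s
    by (rule continuous_on_compose2[OF tnorm_continuous continuous_on_subset[OF zc]]) (use that in auto)
  have rhs: "tnorm (N\<^sup>2 *\<^sub>R R (z r) + W r (z r)) \<le> c * tnorm (z r)" if r: "r \<in> {t..T}" for r
  proof -
    have "tnorm (N\<^sup>2 *\<^sub>R R (z r)) \<le> N\<^sup>2 * (tnorm (z r) / (N - \<omega>))"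
      using mult_left_mono[OF tnorm_resolvent[OF N(2)] zero_le_power2[of N]] by (simp add: tnorm_scaleR R_def)
    moreover have "tnorm (W r (z r)) \<le> M * (w * tnorm (z r))"
    proof -
      have "norm (W r (z r)) \<le> w * tnorm (z r)"
        using norm_blinfun[of "W r" "z r"] mult_mono[OF W(1)[OF r] norm_le_tnorm[of "z r"]] W(2) by simp
      hence "M * norm (W r (z r)) \<le> M * (w * tnorm (z r))" using M by (intro mult_left_mono) auto
      thus ?thesis using tnorm_le[of "W r (z r)"] by simp
    qed
    ultimately show ?thesis using tnorm_add[of "N\<^sup>2 *\<^sub>R R (z r)" "W r (z r)"] by (simp add: c_def algebra_simps)
  qed
  have "tnorm (z s) \<le> tnorm (z t) + c * integral {t..s} (\<lambda>r. tnorm (z r))" if s: "s \<in> {t..T}" for s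
  proof (rule tnorm_least)
    fix \<tau> :: real assume \<tau>: "0 \<le> \<tau>"
    let ?g = "\<lambda>r. E \<tau> (N\<^sup>2 *\<^sub>R R (z r) + W r (z r))"
    have "((\<lambda>r. E \<tau> (z r)) has_vector_derivative ?g r) (at r within {t..s})" if "r \<in> {t..s}" for r
      by (rule bounded_linear.has_vector_derivative[OF blinfun.bounded_linear_right
            has_vector_derivative_within_subset[OF dz]]) (use that s in auto)
    hence gi: "(?g has_integral (E \<tau> (z s) - E \<tau> (z t))) {t..s}"
      using s by (intro fundamental_theorem_of_calculus) auto
    have ti: "(\<lambda>r. tnorm (z r)) integrable_on {t..s}" by (intro integrable_continuous_real tz s)
    have "norm (integral {t..s} ?g) \<le> integral {t..s} (\<lambda>r. (exp (\<omega> * \<tau>) * c) * tnorm (z r))"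
    proof (rule integral_norm_bound_integral)
      show "?g integrable_on {t..s}" using gi by blast
      show "(\<lambda>r. exp (\<omega> * \<tau>) * c * tnorm (z r)) integrable_on {t..s}"
        using integrable_on_cmult_left[OF ti, of "exp (\<omega> * \<tau>) * c"] by simp
      fix r assume r: "r \<in> {t..s}"
      have "norm (?g r) \<le> exp (\<omega> * \<tau>) * tnorm (N\<^sup>2 *\<^sub>R R (z r) + W r (z r))" by (rule orbit_le_tnorm[OF \<tau>])
      also have "\<dots> \<le> exp (\<omega> * \<tau>) * (c * tnorm (z r))" using rhs[of r] r s by (intro mult_left_mono) auto
      finally show "norm (?g r) \<le> exp (\<omega> * \<tau>) * c * tnorm (z r)" by (simp add: mult_ac)
    qed
    hence "norm (E \<tau> (z s) - E \<tau> (z t)) \<le> exp (\<omega> * \<tau>) * (c * integral {t..s} (\<lambda>r. tnorm (z r)))"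
      using integral_unique[OF gi] by (simp add: mult_ac)
    thus "norm (E \<tau> (z s)) \<le> exp (\<omega> * \<tau>) * (tnorm (z t) + c * integral {t..s} (\<lambda>r. tnorm (z r)))"
      using orbit_le_tnorm[OF \<tau>, of "z t"] norm_triangle_sub[of "E \<tau> (z s)" "E \<tau> (z t)"]
      by (simp add: algebra_simps)
  qed
  hence "tnorm (z s) \<le> tnorm (z t) * exp (c * (s - t))"
    by (intro gronwall[OF _ c _ s]) (use s tz[of T] in auto)
  also have "\<dots> \<le> M * norm (y t) * exp (c * (s - t))"
    using tnorm_le[of "y t"] by (intro mult_right_mono) (auto simp: z_def)
  finally have "norm (z s) \<le> M * norm (y t) * exp (c * (s - t))" using norm_le_tnorm[of "z s"] by simp
  hence "exp (- N * (s - t)) * norm (z s) \<le> exp (- N * (s - t)) * (M * norm (y t) * exp (c * (s - t)))"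
    by (intro mult_left_mono) auto
  moreover have "exp (- N * (s - t)) * norm (z s) = norm (y s)"
    by (simp add: z_def mult.assoc[symmetric] exp_add[symmetric])
  moreover have "exp (- N * (s - t)) * (M * norm (y t) * exp (c * (s - t))) = M * exp ((c - N) * (s - t)) * norm (y t)"
  proof -
    have "exp ((c - N) * (s - t)) = exp (- N * (s - t)) * exp (c * (s - t))"
      unfolding exp_add[symmetric] by (simp add: left_diff_distrib)
    thus ?thesis by simp
  qed
  ultimately have "norm (y s) \<le> M * exp ((c - N) * (s - t)) * norm (y t)" by linarith
  moreover have "c - N = \<omega> + \<omega>\<^sup>2 / (N - \<omega>) + M * w"
    using N by (simp add: c_def field_simps power2_eq_square)
  ultimately show ?thesis by (simp add: N_def)
qed

text \<open>
  The number \<open>\<delta>\<close> is the distance from \<open>\<omega>\<close> to the next larger integer, hence a lower bound for \<open>n - \<omega>\<close>.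
\<close>
lemma yosida_propagator_uniform_bound:
  assumes T: "0 \<le> T" and W: "\<And>s. s \<in> {0..T} \<Longrightarrow> norm (W s) \<le> w" "0 \<le> w"
  shows "\<exists>m. \<forall>n t s y. 0 < n \<and> \<omega> < real n \<and> 0 \<le> t \<and> s \<in> {t..T} \<and>
    (\<forall>s\<in>{t..T}. (y has_vector_derivative yosida D A n (y s) + blinfun_apply (W s) (y s)) (at s within {t..T}))
    \<longrightarrow> norm (y s) \<le> m * norm (y t)"
proof -
  define \<delta> where "\<delta> = of_int (\<lfloor>\<omega>\<rfloor> + 1) - \<omega>"
  define \<kappa> where "\<kappa> = \<bar>\<omega>\<bar> + \<omega>\<^sup>2 / \<delta> + M * w"
  have \<delta>: "\<delta> > 0" unfolding \<delta>_def by linarith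
  have \<kappa>: "\<kappa> \<ge> 0" using \<delta> M W(2) by (simp add: \<kappa>_def)
  have "norm (y s) \<le> M * exp (\<kappa> * T) * norm (y t)"
    if n: "0 < n" "\<omega> < real n" and ts: "0 \<le> t" "s \<in> {t..T}"
      and y: "\<And>s. s \<in> {t..T} \<Longrightarrow> (y has_vector_derivative yosida D A n (y s) + blinfun_apply (W s) (y s)) (at s within {t..T})"
    for n t s y
  proof -
    have "\<lfloor>\<omega>\<rfloor> < int n" using n(2) by linarith
    hence "of_int (\<lfloor>\<omega>\<rfloor> + 1) \<le> (of_int (int n) :: real)" by (subst of_int_le_iff) simp
    hence "\<delta> \<le> real n - \<omega>" by (simp add: \<delta>_def)
    hence "\<omega>\<^sup>2 / (real n - \<omega>) \<le> \<omega>\<^sup>2 / \<delta>" using \<delta> by (intro divide_left_mono) auto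
    hence "\<omega> + \<omega>\<^sup>2 / (real n - \<omega>) + M * w \<le> \<kappa>" by (simp add: \<kappa>_def)
    hence "(\<omega> + \<omega>\<^sup>2 / (real n - \<omega>) + M * w) * (s - t) \<le> \<kappa> * (s - t)" using ts by (intro mult_right_mono) auto
    also have "\<dots> \<le> \<kappa> * T" using \<kappa> ts by (intro mult_left_mono) auto
    finally have "exp ((\<omega> + \<omega>\<^sup>2 / (real n - \<omega>) + M * w) * (s - t)) \<le> exp (\<kappa> * T)" by simp
    hence "M * exp ((\<omega> + \<omega>\<^sup>2 / (real n - \<omega>) + M * w) * (s - t)) * norm (y t) \<le> M * exp (\<kappa> * T) * norm (y t)"
      using M by (intro mult_right_mono mult_left_mono) auto
    moreover have "norm (y s) \<le> M * exp ((\<omega> + \<omega>\<^sup>2 / (real n - \<omega>) + M * w) * (s - t)) * norm (y t)"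
      by (rule yosida_propagator_bound[OF n _ W(2) y ts(2)]) (use W(1) ts in auto)
    ultimately show ?thesis by simp
  qed
  thus ?thesis by blast
qed

end

section \<open>Strict solutions and their uniform bound\<close>

theorem propositionA4:
  fixes D :: "'h::{real_inner, banach, second_countable_topology} set"
    and A :: "'h \<Rightarrow> 'h"
    and E :: "real \<Rightarrow> 'h \<Rightarrow>\<^sub>L 'h"
    and B :: "'u::{real_inner, banach, second_countable_topology} \<Rightarrow>\<^sub>L 'h"
    and R :: "'u \<Rightarrow>\<^sub>L 'u"
    and Q Q\<^sub>T Qbar Qbar\<^sub>T S S\<^sub>T :: "'h \<Rightarrow>\<^sub>L 'h"
    and P :: "real \<Rightarrow> 'h \<Rightarrow>\<^sub>L 'h"
    and T M \<omega> \<epsilon> :: real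
  defines "K \<equiv> B o\<^sub>L op_inverse R o\<^sub>L adj B"
    and "N \<equiv> {n::nat. 0 < n \<and> \<omega> < real n}"
  assumes "closed_densely_defined D A" and "generates D A E"
    and "1 \<le> M" and "\<And>t. 0 \<le> t \<Longrightarrow> norm (E t) \<le> M * exp (\<omega> * t)"
    and "Q \<in> nonneg_ops" and "Q\<^sub>T \<in> nonneg_ops"
    and "Qbar \<in> self_adjoint_ops" and "Qbar\<^sub>T \<in> self_adjoint_ops"
    and "Q + Qbar \<in> nonneg_ops" and "Q\<^sub>T + Qbar\<^sub>T \<in> nonneg_ops"
    and "R \<in> self_adjoint_ops" and "0 < \<epsilon>" and "\<And>a. \<epsilon> * (norm a)\<^sup>2 \<le> R a \<bullet> a"
    and "0 < T"
    and "mild_riccati T E K (Q + Qbar) (Q\<^sub>T + Qbar\<^sub>T) P"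
    and "- (Qbar o\<^sub>L S) \<in> nonneg_ops" and "- (Qbar\<^sub>T o\<^sub>L S\<^sub>T) \<in> nonneg_ops"
  shows
    "(\<forall>n\<in>N. \<exists>\<eta>. strict_eta_riccati T P K (yosida D A n) (Qbar o\<^sub>L S) (- (Qbar\<^sub>T o\<^sub>L S\<^sub>T)) \<eta>) \<and>
     (\<forall>\<eta>. (\<forall>n\<in>N. strict_eta_riccati T P K (yosida D A n) (Qbar o\<^sub>L S) (- (Qbar\<^sub>T o\<^sub>L S\<^sub>T)) (\<eta> n)) \<longrightarrow>
        bdd_above ((\<lambda>(n, t). norm (\<eta> n t)) ` (N \<times> {0..T})))"
proof -
  interpret semigroup_generator D A E M \<omega>
    by unfold_locales (use assms in auto)
  define C where "C = - (Qbar o\<^sub>L S)"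
  define G where "G = - (Qbar\<^sub>T o\<^sub>L S\<^sub>T)"
  have K: "K \<in> nonneg_ops"
    unfolding K_def by (rule nonneg_control_weight) (use assms in auto)
  have P: "P t \<in> self_adjoint_ops" if "t \<in> {0..T}" for t
    using assms that unfolding mild_riccati_def Cs_def nonneg_ops_def by auto
  have P_cont: "continuous_on {0..T} (\<lambda>t. P t x)" for x
    using assms unfolding mild_riccati_def Cs_def by auto
  obtain p where p: "0 \<le> p" "\<And>t. t \<in> {0..T} \<Longrightarrow> norm (P t) \<le> p"
    using strongly_continuous_bounded[of 0 T P] P_cont by blast
  define L where "L n t = yosida D A n - (K o\<^sub>L P t)" for n t
  have ric: "riccati T (L n) K C G" for n
  proof
    have "P t v \<bullet> w = v \<bullet> P t w" if "t \<in> {0..T}" for t v w using P[OF that] self_adjoint_ops_iff by blast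
    moreover have "K v \<bullet> w = v \<bullet> K w" for v w using K self_adjoint_ops_iff unfolding nonneg_ops_def by blast
    ultimately have adjL: "adj (L n t) = adj (yosida D A n) - (P t o\<^sub>L K)" if "t \<in> {0..T}" for t
      using that by (intro adj_eqI) (simp add: L_def blinfun.bilinear_simps inner_simps adj_apply)
    fix x
    show "continuous_on {0..T} (\<lambda>t. L n t x)"
      unfolding L_def blinfun.diff_left blinfun_apply_blinfun_compose
      by (intro continuous_on_diff continuous_on_const bounded_linear.continuous_on[OF blinfun.bounded_linear_right] P_cont)
    have "continuous_on {0..T} (\<lambda>t. adj (yosida D A n) x - P t (K x))"
      by (intro continuous_on_diff continuous_on_const P_cont)
    thus "continuous_on {0..T} (\<lambda>t. adj (L n t) x)"
      by (rule continuous_on_eq) (simp add: adjL blinfun.diff_left)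
  qed (use assms K in \<open>auto simp: C_def G_def\<close>)
  have iff: "strict_eta_riccati T P K (yosida D A n) (Qbar o\<^sub>L S) (- (Qbar\<^sub>T o\<^sub>L S\<^sub>T)) \<eta>
      \<longleftrightarrow> riccati.solves T (L n) K C G (\<lambda>_. 1) \<eta>" for n \<eta>
    using riccati.strict_eta_riccati_iff_solves[OF ric[of n], of "yosida D A n" P \<eta>] P
    by (simp add: L_def C_def G_def)
  have W: "norm (- (K o\<^sub>L P s)) \<le> norm K * p" if "s \<in> {0..T}" for s
    using norm_blinfun_compose[of K "P s"] mult_left_mono[OF p(2)[OF that] norm_ge_zero[of K]] by simp
  have "0 \<le> T" "0 \<le> norm K * p" using assms p by auto
  from yosida_propagator_uniform_bound[where W = "\<lambda>s. - (K o\<^sub>L P s)", OF this(1) W this(2)]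
  obtain m where m: "\<And>n t s y. \<lbrakk>0 < n; \<omega> < real n; 0 \<le> t; s \<in> {t..T};
      \<forall>s\<in>{t..T}. (y has_vector_derivative yosida D A n (y s) + (- (K o\<^sub>L P s)) (y s)) (at s within {t..T})\<rbrakk>
      \<Longrightarrow> norm (y s) \<le> m * norm (y t)"
    by blast
  have propagators: "riccati.propagator_bound T (L n) m" if n: "n \<in> N" for n
    unfolding riccati.propagator_bound_def[OF ric]
  proof (intro ballI allI impI)
    fix t s y assume t: "t \<in> {0..T}" and s: "s \<in> {t..T}"
      and y: "\<forall>s\<in>{t..T}. (y has_vector_derivative L n s (y s)) (at s within {t..T})"
    show "norm (y s) \<le> m * norm (y t)"
      by (rule m) (use n t s y in \<open>auto simp: N_def L_def blinfun.bilinear_simps\<close>)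
  qed
  have exists: "\<exists>\<eta>. riccati.solves T (L n) K C G (\<lambda>_. 1) \<eta>" if "n \<in> N" for n
    by (rule riccati.solution_exists[OF ric propagators[OF that]])
  have bound: "norm (\<eta> t) \<le> (norm G + T * norm C) * m\<^sup>2"
    if "n \<in> N" "riccati.solves T (L n) K C G (\<lambda>_. 1) \<eta>" "t \<in> {0..T}" for n \<eta> t
    by (rule riccati.solution_bound[OF ric that(2) _ _ propagators[OF that(1)] that(3)]) auto
  show ?thesis unfolding iff
    using exists bound by (auto intro!: bdd_aboveI2[where M = "(norm G + T * norm C) * m\<^sup>2"])
qed

end
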